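(* For every $k\ge2$ and all $c$ sufficiently large, $$\left(\frac{2^k-1}{2^k}c+\frac{2}{k+1}\sqrt{\frac{ck}{\pi2^k}}-O(1)\right)n\;\lesssim\; f_k(n,cn)\;\lesssim\;\left(\frac{2^k-1}{2^k}c+\sqrt c\,\sqrt{\frac{(2^k-1)\ln2}{2^{2k-1}}}\right)n.$$
   Context: A random $k$-SAT formula $F_k(n,m)$ on variables $X_1,\dots,X_n$ consists of $m$ clauses, each chosen independently and uniformly at random (with replacement) from the $2^k\binom nk$ proper $k$-clauses (disjunctions of $k$ literals on $k$ distinct variables). $\max F$ is the maximum over truth assignments of the number of clauses satisfied, $f_k(n,m)=\mathbb{E}[\max F_k(n,m)]$, and $cn$ means $\lfloor cn\rfloor$. Notation: $a(n)\lesssim b(n)$ means $\limsup_{n\to\infty}a(n)/b(n)\le1$; the limit in $n$ is taken first for fixed $c$, then $c$ is taken large, with the $O(1)$ term bounded independently of $c$. *)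

theory Defs
  imports "HOL-Probability.Probability" "HOL-Library.Landau_Symbols"
begin

text \<open>A literal is a variable index with a sign: \<open>(i, True)\<close> is $X_i$ and \<open>(i, False)\<close> is its
  negation. A clause is the set of literals of the disjunction, a formula the list of its clauses,
  so repeated clauses count with multiplicity.\<close>

type_synonym literal = "nat \<times> bool"
type_synonym clause = "literal set"
type_synonym formula = "clause list"

definition proper_clauses :: "nat \<Rightarrow> nat \<Rightarrow> clause set" where
  "proper_clauses k n = {C. C \<subseteq> {1..n} \<times> UNIV \<and> card C = k \<and> inj_on fst C}"

definition satisfies :: "(nat \<Rightarrow> bool) \<Rightarrow> clause \<Rightarrow> bool" where
  "satisfies \<sigma> C \<longleftrightarrow> (\<exists>(i, b)\<in>C. \<sigma> i = b)"

definition num_satisfied :: "(nat \<Rightarrow> bool) \<Rightarrow> formula \<Rightarrow> nat" where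
  "num_satisfied \<sigma> F = length (filter (satisfies \<sigma>) F)"

definition max_sat :: "nat \<Rightarrow> formula \<Rightarrow> nat" where
  "max_sat n F = Max ((\<lambda>\<sigma>. num_satisfied \<sigma> F) ` ({1..n} \<rightarrow>\<^sub>E UNIV))"

text \<open>Meaningful only for \<open>k \<le> n\<close>: otherwise there are no proper clauses, and
  \<open>pmf_of_set {}\<close> is unspecified.\<close>

definition random_formula :: "nat \<Rightarrow> nat \<Rightarrow> nat \<Rightarrow> formula pmf" where
  "random_formula k n m = replicate_pmf m (pmf_of_set (proper_clauses k n))"

definition expected_max_sat :: "nat \<Rightarrow> nat \<Rightarrow> nat \<Rightarrow> real" where
  "expected_max_sat k n m =
     measure_pmf.expectation (random_formula k n m) (\<lambda>F. real (max_sat n F))"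

definition asymp_le :: "(nat \<Rightarrow> real) \<Rightarrow> (nat \<Rightarrow> real) \<Rightarrow> bool"  (infix \<open>\<lesssim>\<close> 50) where
  "a \<lesssim> b \<longleftrightarrow> limsup (\<lambda>n. ereal (a n / b n)) \<le> 1"

end

theory Submission
  imports Defs "HOL-Real_Asymp.Real_Asymp"
begin

text \<open>
  Upper bound: by the exponential moment method over the \<open>2 ^ n\<close> assignments. A clause is satisfied
  with probability \<open>q = 1 - 2 ^ -k \<ge> 1/2\<close>, and for \<open>q \<ge> 1/2\<close> the moment generating function of a
  Bernoulli variable is dominated, for positive arguments, by that of the normal variable with the
  same mean and variance.

  Lower bound: variables are set in the order \<open>1, \<dots>, n\<close>. A clause matters for variable \<open>i\<close>, its
  last variable, only if all its other literals are already false; \<open>i\<close> is set according to the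
  majority of these clauses. Clauses with different last variables are disjoint, so the signs seen
  at step \<open>i\<close> are independent of the earlier choices, and the gain at step \<open>i\<close> is
  half the mean distance \<open>E \<bar>S\<bar>\<close> of a symmetric random walk. The walk makes a step for each clause with
  probability \<open>r\<^sub>i = 2 (i-1 choose k-1) / (2 ^ k (n choose k))\<close>, so that
  \<open>E \<bar>S\<bar> \<ge> sqrt (2 / pi) (sqrt (m r\<^sub>i) - 2)\<close>. Summing over \<open>i\<close> gives the
  Riemann sum of \<open>x ^ ((k-1)/2)\<close>, whence the factor \<open>2 / (k + 1)\<close>.

  To avoid conditioning on the run of the algorithm, it is simulated by an injective map on
  formulas: the majority assignment \<open>\<sigma>\<close> is read off a formula \<open>G\<close> as if all earlier variables were
  set to true, and then the non-last literals are re-signed so that \<open>\<sigma>\<close> treats them as the all-true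
  assignment treated them in \<open>G\<close>. The map permutes the formulas, hence preserves the uniform
  distribution.
\<close>

subsection \<open>Expectations over independent samples\<close>

lemma expectation_replicate_pmf_Suc:
  fixes f :: "'a list \<Rightarrow> real"
  assumes "finite (set_pmf p)"
  shows "measure_pmf.expectation (replicate_pmf (Suc n) p) f =
    measure_pmf.expectation p (\<lambda>x. measure_pmf.expectation (replicate_pmf n p) (\<lambda>xs. f (x # xs)))"
proof -
  have fin: "finite (set_pmf (replicate_pmf n p))"
    using finite_lists_length_eq[OF assms, of n]
    by (auto simp: set_replicate_pmf lists_eq_set elim!: finite_subset[rotated])
  have "measure_pmf.expectation (replicate_pmf (Suc n) p) f =
      (\<Sum>x\<in>set_pmf p. pmf p x *\<^sub>R
        measure_pmf.expectation (replicate_pmf n p \<bind> (\<lambda>xs. return_pmf (x # xs))) f)"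
    unfolding replicate_pmf.simps by (rule pmf_expectation_bind) (use assms fin in auto)
  also have "\<dots> = measure_pmf.expectation p (\<lambda>x. measure_pmf.expectation (replicate_pmf n p) (\<lambda>xs. f (x # xs)))"
    by (subst integral_measure_pmf[OF assms]) (auto simp: map_pmf_def[symmetric])
  finally show ?thesis .
qed

lemma integrable_replicate_pmf [simp]:
  fixes f :: "'a list \<Rightarrow> real"
  assumes "finite (set_pmf p)"
  shows "integrable (replicate_pmf n p) f"
proof (rule integrable_measure_pmf_finite)
  show "finite (set_pmf (replicate_pmf n p))"
    using finite_lists_length_eq[OF assms, of n]
    by (auto simp: set_replicate_pmf lists_eq_set elim!: finite_subset[rotated])
qed

lemma expectation_replicate_pmf_mono:
  fixes f g :: "'a list \<Rightarrow> real"
  assumes "finite (set_pmf p)"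
    and "\<And>xs. set xs \<subseteq> set_pmf p \<Longrightarrow> length xs = n \<Longrightarrow> f xs \<le> g xs"
  shows "measure_pmf.expectation (replicate_pmf n p) f \<le> measure_pmf.expectation (replicate_pmf n p) g"
  by (rule integral_mono_AE) (use assms in \<open>auto simp: AE_measure_pmf_iff set_replicate_pmf lists_eq_set\<close>)

lemma expectation_replicate_pmf_sum_list:
  fixes h :: "'a \<Rightarrow> real"
  assumes "finite (set_pmf p)"
  shows "measure_pmf.expectation (replicate_pmf n p) (\<lambda>xs. \<Sum>x\<leftarrow>xs. h x) =
    n * measure_pmf.expectation p h"
  using assms
  by (induction n)
     (simp_all add: expectation_replicate_pmf_Suc integrable_measure_pmf_finite algebra_simps
       del: replicate_pmf.simps(2))

lemma expectation_replicate_pmf_prod_list: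
  fixes h :: "'a \<Rightarrow> real"
  assumes "finite (set_pmf p)"
  shows "measure_pmf.expectation (replicate_pmf n p) (\<lambda>xs. \<Prod>x\<leftarrow>xs. h x) =
    measure_pmf.expectation p h ^ n"
  using assms
  by (induction n)
     (simp_all add: expectation_replicate_pmf_Suc integrable_measure_pmf_finite
       del: replicate_pmf.simps(2))

text \<open>Cross terms vanish because \<open>h\<close> has mean zero. This supplies the variance of
  the number of nonzero votes.\<close>

lemma expectation_replicate_pmf_sum_list_square:
  fixes h :: "'a \<Rightarrow> real"
  assumes fin: "finite (set_pmf p)" and zero: "measure_pmf.expectation p h = 0"
  shows "measure_pmf.expectation (replicate_pmf n p) (\<lambda>xs. (\<Sum>x\<leftarrow>xs. h x)\<^sup>2) =
    n * measure_pmf.expectation p (\<lambda>x. (h x)\<^sup>2)"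
proof (induction n)
  case (Suc n)
  have "measure_pmf.expectation (replicate_pmf n p) (\<lambda>xs. (h x + (\<Sum>x\<leftarrow>xs. h x))\<^sup>2) =
      (h x)\<^sup>2 + n * measure_pmf.expectation p (\<lambda>x. (h x)\<^sup>2)" for x
    by (simp add: power2_sum fin Suc expectation_replicate_pmf_sum_list zero)
  then show ?case
    using fin by (simp add: expectation_replicate_pmf_Suc integrable_measure_pmf_finite algebra_simps
        del: replicate_pmf.simps(2))
qed simp

lemma expectation_replicate_pmf_of_set:
  fixes f :: "'a list \<Rightarrow> real"
  assumes "finite A" "A \<noteq> {}"
  shows "measure_pmf.expectation (replicate_pmf n (pmf_of_set A)) f =
    (\<Sum>xs | set xs \<subseteq> A \<and> length xs = n. f xs) / real (card A) ^ n"
proof (induction n arbitrary: f)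
  case 0
  have "{xs. set xs \<subseteq> A \<and> xs = []} = {[]}" by auto
  then show ?case by simp
next
  case (Suc n)
  let ?L = "\<lambda>n. {xs. set xs \<subseteq> A \<and> length xs = n}"
  have "bij_betw (\<lambda>(x, xs). x # xs) (A \<times> ?L n) (?L (Suc n))"
    by (rule bij_betwI[where g = "\<lambda>xs. (hd xs, tl xs)"]) (auto simp: length_Suc_conv)
  then have "(\<Sum>xs\<in>?L (Suc n). f xs) = (\<Sum>(x, xs)\<in>A \<times> ?L n. f (x # xs))"
    by (subst sum.reindex_bij_betw[symmetric]) (auto simp: case_prod_unfold)
  also have "\<dots> = (\<Sum>x\<in>A. \<Sum>xs\<in>?L n. f (x # xs))"
    by (simp add: sum.cartesian_product)
  finally show ?case
    using assms by (simp add: expectation_replicate_pmf_Suc Suc integral_pmf_of_set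
        sum_divide_distrib mult.commute del: replicate_pmf.simps(2))
qed

text \<open>An injective self-map of the finite set of samples is a permutation, hence preserves the
  uniform law.\<close>

lemma expectation_replicate_pmf_of_set_inj:
  fixes f :: "'a list \<Rightarrow> real"
  assumes "finite A" "A \<noteq> {}"
    and "inj_on \<Phi> {xs. set xs \<subseteq> A \<and> length xs = n}"
    and "\<And>xs. set xs \<subseteq> A \<Longrightarrow> length xs = n \<Longrightarrow> set (\<Phi> xs) \<subseteq> A \<and> length (\<Phi> xs) = n"
  shows "measure_pmf.expectation (replicate_pmf n (pmf_of_set A)) (\<lambda>xs. f (\<Phi> xs)) =
    measure_pmf.expectation (replicate_pmf n (pmf_of_set A)) f"
proof -
  let ?L = "{xs. set xs \<subseteq> A \<and> length xs = n}"
  have "finite ?L" by (rule finite_lists_length_eq) fact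
  moreover have "\<Phi> ` ?L \<subseteq> ?L" using assms(4) by blast
  ultimately have "bij_betw \<Phi> ?L ?L"
    using assms(3) by (metis (no_types, lifting) bij_betw_def endo_inj_surj)
  then show ?thesis
    unfolding expectation_replicate_pmf_of_set[OF assms(1,2)]
    by (subst sum.reindex_bij_betw[symmetric, where h = \<Phi>]) auto
qed

subsection \<open>The mean absolute value of a random walk\<close>

text \<open>The averaging operator of the simple symmetric walk: \<open>(walk_step ^^ n) f x\<close>
  is the mean of \<open>f\<close> after \<open>n\<close> steps from \<open>x\<close>.\<close>

definition walk_step :: "(int \<Rightarrow> real) \<Rightarrow> int \<Rightarrow> real" where
  "walk_step f x = (f (x + 1) + f (x - 1)) / 2"

lemma sum_choose_Suc:
  fixes g :: "nat \<Rightarrow> real"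
  shows "(\<Sum>j\<le>Suc n. real (Suc n choose j) * g j) = (\<Sum>j\<le>n. real (n choose j) * (g j + g (Suc j)))"
proof -
  have *: "(\<Sum>j\<le>n. real (n choose Suc j) * g (Suc j)) = (\<Sum>j\<le>n. real (n choose j) * g j) - g 0"
    using sum.atMost_Suc_shift[of "\<lambda>j. real (n choose j) * g j" n] by (simp add: binomial_eq_0)
  show ?thesis
    using * by (subst sum.atMost_Suc_shift) (simp add: sum.distrib algebra_simps)
qed

text \<open>\<open>j\<close> counts the downward steps; the induction is Pascal's rule.\<close>

lemma funpow_walk_step:
  "(walk_step ^^ n) f x = (\<Sum>j\<le>n. real (n choose j) * f (x + int n - 2 * int j)) / 2 ^ n"
proof (induction n arbitrary: x)
  case (Suc n)
  have "(walk_step ^^ Suc n) f x =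
      (\<Sum>j\<le>n. real (n choose j) * (f (x + 1 + int n - 2 * int j) + f (x - 1 + int n - 2 * int j))) / 2 ^ Suc n"
    by (simp add: walk_step_def Suc.IH sum.distrib distrib_left add_divide_distrib)
  also have "\<dots> = (\<Sum>j\<le>Suc n. real (Suc n choose j) * f (x + int (Suc n) - 2 * int j)) / 2 ^ Suc n"
    by (subst sum_choose_Suc) (simp add: algebra_simps)
  finally show ?case .
qed simp

text \<open>\<open>\<bar>S\<bar>\<close> grows in the mean only at visits to \<open>0\<close>, so its mean is the sum of the return
  probabilities.\<close>

lemma funpow_walk_step_abs_Suc:
  "(walk_step ^^ Suc n) (\<lambda>x. \<bar>real_of_int x\<bar>) 0 =
    (walk_step ^^ n) (\<lambda>x. \<bar>real_of_int x\<bar>) 0 + (if even n then real (n choose (n div 2)) / 2 ^ n else 0)"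
proof -
  have step: "walk_step (\<lambda>x. \<bar>real_of_int x\<bar>) = (\<lambda>x. \<bar>real_of_int x\<bar> + (if x = 0 then 1 else 0))"
    by (rule ext) (auto simp: walk_step_def)
  have "(\<Sum>j\<le>n. real (n choose j) * (if int n - 2 * int j = 0 then 1 else 0)) =
      (if even n then real (n choose (n div 2)) else 0)"
  proof -
    have "(\<Sum>j\<le>n. real (n choose j) * (if int n - 2 * int j = 0 then 1 else 0)) =
        (\<Sum>j\<in>{..n} \<inter> {j. n = 2 * j}. real (n choose j))"
      by (subst sum.inter_restrict) (auto intro!: sum.cong)
    moreover have "{..n} \<inter> {j. n = 2 * j} = (if even n then {n div 2} else {})" by auto
    ultimately show ?thesis by simp
  qed
  then have "(walk_step ^^ n) (\<lambda>x. if x = 0 then 1 else 0) 0 =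
      (if even n then real (n choose (n div 2)) / 2 ^ n else 0)"
    unfolding funpow_walk_step by simp
  moreover have "(walk_step ^^ Suc n) (\<lambda>x. \<bar>real_of_int x\<bar>) 0 =
      (walk_step ^^ n) (\<lambda>x. \<bar>real_of_int x\<bar>) 0 + (walk_step ^^ n) (\<lambda>x. if x = 0 then 1 else 0) 0"
    unfolding funpow_Suc_right comp_def step
    by (simp add: funpow_walk_step sum.distrib distrib_left add_divide_distrib)
  ultimately show ?thesis by simp
qed

text \<open>The partial Wallis products \<open>W n\<close> satisfy
  \<open>W n * (b n)\<^sup>2 * (2 * n + 1) = 1\<close>, where \<open>b n\<close> is the left-hand
  side, and they increase to \<open>pi / 2\<close>.\<close>

lemma central_binomial_ge:
  "real ((2 * n) choose n) / 4 ^ n \<ge> 1 / sqrt (pi * (n + 1 / 2))"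
proof -
  define W where "W n = (\<Prod>k=1..n. (4 * real k ^ 2) / (4 * real k ^ 2 - 1))" for n
  define b where "b n = real ((2 * n) choose n) / 4 ^ n" for n
  have b_Suc: "b (Suc n) = b n * (2 * n + 1) / (2 * n + 2)" for n
  proof -
    have choose: "real ((2 * m) choose m) = fact (2 * m) / (fact m)\<^sup>2" for m
      using binomial_fact[of m "2 * m", where 'a = real] by (simp add: power2_eq_square)
    show ?thesis
      unfolding b_def choose
      by (simp add: divide_simps power2_eq_square) (simp add: algebra_simps)
  qed
  have b_pos: "b n > 0" for n by (simp add: b_def)
  have W: "W n * (b n)\<^sup>2 * (2 * n + 1) = 1" for n
  proof (induction n)
    case 0 then show ?case by (simp add: W_def b_def)
  next
    case (Suc n)
    \<comment> \<open>\<open>F\<close> and \<open>G\<close> are the ratios of consecutive values of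
      \<open>W\<close> and \<open>b\<close>, and \<open>H\<close> is the next odd factor. The
      induction step thus reduces to \<open>F * G\<^sup>2 * H = 2 * n + 1\<close>.\<close>
    define F G H where "F = (2 * real n + 2)\<^sup>2 / ((2 * n + 1) * (2 * n + 3))"
      and "G = (2 * real n + 1) / (2 * n + 2)" and "H = 2 * real n + 3"
    have "W (Suc n) = W n * F"
      by (simp add: W_def F_def power2_eq_square algebra_simps)
    moreover have "b (Suc n) = b n * G" by (simp add: b_Suc G_def add_ac)
    ultimately have "W (Suc n) * (b (Suc n))\<^sup>2 * H = W n * (b n)\<^sup>2 * (F * G\<^sup>2 * H)"
      by (simp add: power_mult_distrib mult_ac)
    also have "F * G\<^sup>2 * H = 2 * n + 1"
      unfolding F_def G_def H_def using of_nat_0_le_iff[of n, where 'a = real]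
      by (simp add: divide_simps power2_eq_square add_nonneg_eq_0_iff) (simp add: algebra_simps)
    finally have "W (Suc n) * (b (Suc n))\<^sup>2 * H = W n * (b n)\<^sup>2 * (2 * n + 1)" .
    moreover have "H = 2 * Suc n + 1" by (simp add: H_def)
    ultimately show ?case using Suc by simp
  qed
  have "incseq W"
  proof (rule incseq_SucI)
    fix n
    have "W n \<ge> 0"
      unfolding W_def
    proof (intro prod_nonneg divide_nonneg_nonneg ballI)
      fix k :: nat assume "k \<in> {1..n}"
      then have "1 \<le> real k ^ 2" by (simp add: one_le_power)
      then show "0 \<le> 4 * real k ^ 2 - 1" by linarith
    qed simp
    moreover have "1 \<le> (4 * real (Suc n) ^ 2) / (4 * real (Suc n) ^ 2 - 1)"
    proof -
      have "1 \<le> real (Suc n) ^ 2" by (rule one_le_power) simp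
      then show ?thesis by (subst le_divide_eq_1_pos) linarith+
    qed
    moreover have "W (Suc n) = W n * ((4 * real (Suc n) ^ 2) / (4 * real (Suc n) ^ 2 - 1))"
      by (simp add: W_def)
    ultimately show "W n \<le> W (Suc n)"
      by (metis mult_left_mono mult.right_neutral)
  qed
  moreover have "W \<longlonglongrightarrow> pi / 2" unfolding W_def by (rule wallis)
  ultimately have "W n \<le> pi / 2" by (rule incseq_le)
  then have "1 \<le> pi / 2 * (b n)\<^sup>2 * (2 * n + 1)"
    using W[of n] mult_right_mono[of "W n" "pi / 2" "(b n)\<^sup>2 * (2 * n + 1)"] by (simp add: mult_ac)
  then have "1 \<le> (b n)\<^sup>2 * (pi * (n + 1 / 2))"
    by (simp add: algebra_simps)
  then have "1 / (pi * (n + 1 / 2)) \<le> (b n)\<^sup>2"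
    by (subst pos_divide_le_eq) (auto intro: mult_pos_pos)
  then have "sqrt (1 / (pi * (n + 1 / 2))) \<le> b n"
    using b_pos[of n] by (intro real_le_lsqrt) auto
  then show ?thesis by (simp add: b_def real_sqrt_divide)
qed

text \<open>The increment at time \<open>2 * m\<close> is at least
  \<open>sqrt (2 / pi) / sqrt (2 * m + 1)\<close>, which dominates the growth of
  \<open>sqrt (2 / pi) * sqrt (2 * m + 1)\<close> from \<open>m\<close> to \<open>m + 1\<close>. The
  \<open>- 1\<close> matches the start \<open>m = 0\<close>.\<close>

lemma funpow_walk_step_abs_ge:
  "(walk_step ^^ n) (\<lambda>x. \<bar>real_of_int x\<bar>) 0 \<ge> sqrt (2 / pi) * (sqrt n - 1)"
proof -
  define w where "w n = (walk_step ^^ n) (\<lambda>x. \<bar>real_of_int x\<bar>) 0" for n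
  have w_Suc: "w (Suc n) = w n + (if even n then real (n choose (n div 2)) / 2 ^ n else 0)" for n
    unfolding w_def by (rule funpow_walk_step_abs_Suc)
  have w0: "w 0 = 0" by (simp add: w_def)
  have sqrt_step: "sqrt (y + 2) - sqrt y \<le> 1 / sqrt y" if "y > 0" for y :: real
  proof -
    have "sqrt y * sqrt (y + 2) \<le> y + 1"
      unfolding real_sqrt_mult[symmetric]
      by (rule real_le_lsqrt) (use that in \<open>simp_all add: power2_eq_square algebra_simps\<close>)
    then show ?thesis using that by (simp add: field_simps)
  qed
  have even: "w (2 * m) \<ge> sqrt (2 / pi) * (sqrt (2 * m + 1) - 1)" for m
  proof (induction m)
    case (Suc m)
    have "sqrt (2 / pi) * (sqrt (2 * m + 3) - sqrt (2 * m + 1)) \<le> sqrt (2 / pi) * (1 / sqrt (2 * m + 1))"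
      using sqrt_step[of "2 * m + 1"] by (intro mult_left_mono) (auto simp: add_ac)
    also have "\<dots> = sqrt (2 / pi * (1 / (2 * m + 1)))"
      by (simp only: real_sqrt_mult real_sqrt_divide real_sqrt_one)
    also have "2 / pi * (1 / (2 * m + 1)) = 1 / (pi * (m + 1 / 2))" by (simp add: field_simps)
    also have "sqrt \<dots> = 1 / sqrt (pi * (m + 1 / 2))" by (simp only: real_sqrt_divide real_sqrt_one)
    also have "\<dots> \<le> real ((2 * m) choose m) / 4 ^ m" by (rule central_binomial_ge)
    also have "\<dots> = w (2 * Suc m) - w (2 * m)" by (simp add: w_Suc power_mult)
    finally show ?case using Suc by (simp add: algebra_simps)
  qed (simp add: w0)
  have mono: "sqrt (2 / pi) * (sqrt x - 1) \<le> sqrt (2 / pi) * (sqrt y - 1)" if "x \<le> y" for x y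
    using that by (intro mult_left_mono) auto
  show ?thesis
  proof (cases "even n")
    case True
    then obtain m where m: "n = 2 * m" by blast
    then have "real n \<le> 2 * m + 1" by simp
    from order_trans[OF mono[OF this] even[of m]] show ?thesis by (simp add: w_def m)
  next
    case False
    then obtain m where m: "n = 2 * m + 1" by (blast elim: oddE)
    \<comment> \<open>The walk is at 0 only at even times, so the mean distance does not change from
      the odd time \<open>n\<close> to \<open>n + 1\<close>, and the even bound at
      \<open>n + 1\<close> applies.\<close>
    have "w (2 * Suc m) = w n" by (simp add: m w_Suc)
    have "real n \<le> 2 * Suc m + 1" by (simp add: m)
    from order_trans[OF mono[OF this] even[of "Suc m"]] show ?thesis
      unfolding \<open>w (2 * Suc m) = w n\<close> by (simp add: w_def)
  qed
qed

section \<open>Walks with a random number of steps\<close>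

lemma sqrt_ge_parabola:
  assumes "\<mu> > 0" "x \<ge> 0"
  shows "sqrt x \<ge> sqrt \<mu> * (1 + (x - \<mu>) / (2 * \<mu>) - (x - \<mu>)\<^sup>2 / (2 * \<mu>\<^sup>2))"
proof -
  \<comment> \<open>In terms of \<open>t\<close> the gap is a square times
    \<open>t * (t + 2) / 2\<close>. The coefficient 1/2, in place of Taylor's 1/8, makes the
    parabola vanish at \<open>x = 0\<close>, which lets the bound hold down to 0. Taking means then
    involves only the mean and variance of \<open>x\<close>.\<close>
  define t where "t = sqrt (x / \<mu>)"
  have t: "t \<ge> 0" "x = t\<^sup>2 * \<mu>" using assms by (simp_all add: t_def)
  have "0 \<le> (t - 1)\<^sup>2 * (t * (t + 2))" using t by simp
  moreover have "t - (1 + (t\<^sup>2 - 1) / 2 - (t\<^sup>2 - 1)\<^sup>2 / 2) = (t - 1)\<^sup>2 * (t * (t + 2)) / 2"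
    by (simp add: power2_eq_square field_simps)
  ultimately have "1 + (t\<^sup>2 - 1) / 2 - (t\<^sup>2 - 1)\<^sup>2 / 2 \<le> t" by linarith
  moreover have "(x - \<mu>) / (2 * \<mu>) = (t\<^sup>2 - 1) / 2"
    using assms by (simp add: t(2) field_simps)
  moreover have "(x - \<mu>)\<^sup>2 / (2 * \<mu>\<^sup>2) = (t\<^sup>2 - 1)\<^sup>2 / 2"
  proof -
    have "(x - \<mu>)\<^sup>2 = (t\<^sup>2 - 1)\<^sup>2 * \<mu>\<^sup>2" by (simp add: t(2) power2_eq_square algebra_simps)
    then show ?thesis using assms by simp
  qed
  ultimately have "1 + (x - \<mu>) / (2 * \<mu>) - (x - \<mu>)\<^sup>2 / (2 * \<mu>\<^sup>2) \<le> t"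
    by (simp only:)
  then have "sqrt \<mu> * (1 + (x - \<mu>) / (2 * \<mu>) - (x - \<mu>)\<^sup>2 / (2 * \<mu>\<^sup>2)) \<le> sqrt \<mu> * t"
    using assms by (intro mult_left_mono) auto
  also have "\<dots> = sqrt x" using assms by (simp add: t_def real_sqrt_divide)
  finally show ?thesis .
qed

text \<open>The hypothesis says that \<open>Y\<close> is 0 with probability \<open>1 - r\<close> and
  1 or -1 with probability \<open>r / 2\<close> each. Given which samples have nonzero
  \<open>Y\<close>, the signs are fair and independent, so the sum is a simple walk whose length is
  the number of those samples.\<close>

lemma expectation_abs_sum_ternary:
  fixes Y :: "'a \<Rightarrow> int"
  assumes fin: "finite (set_pmf p)"
    and Y: "\<And>f :: int \<Rightarrow> real. measure_pmf.expectation p (\<lambda>x. f (Y x)) = (1 - r) * f 0 + r * (f 1 + f (- 1)) / 2"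
  shows "measure_pmf.expectation (replicate_pmf n p) (\<lambda>xs. \<bar>real_of_int (z + (\<Sum>x\<leftarrow>xs. Y x))\<bar>) =
    measure_pmf.expectation (replicate_pmf n p)
      (\<lambda>xs. (walk_step ^^ (\<Sum>x\<leftarrow>xs. nat \<bar>Y x\<bar>)) (\<lambda>x. \<bar>real_of_int x\<bar>) z)"
proof (induction n arbitrary: z)
  case (Suc n)
  \<comment> \<open>The index \<open>k\<close> holds walk steps not yet averaged: a nonzero first
    sample turns \<open>e 0\<close> into \<open>e 1\<close>, a zero one leaves
    \<open>e 0\<close>.\<close>
  define e where "e k z = measure_pmf.expectation (replicate_pmf n p)
      (\<lambda>xs. (walk_step ^^ (k + (\<Sum>x\<leftarrow>xs. nat \<bar>Y x\<bar>))) (\<lambda>x. \<bar>real_of_int x\<bar>) z)" for k z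
  have e1: "e 1 z = (e 0 (z + 1) + e 0 (z - 1)) / 2"
    using fin by (simp add: e_def walk_step_def)
  have "measure_pmf.expectation (replicate_pmf (Suc n) p) (\<lambda>xs. \<bar>real_of_int (z + (\<Sum>x\<leftarrow>xs. Y x))\<bar>) =
      measure_pmf.expectation p (\<lambda>x. e 0 (z + Y x))"
    unfolding expectation_replicate_pmf_Suc[OF fin] e_def add_0 Suc[symmetric] by (simp add: add.assoc)
  also have "\<dots> = (1 - r) * e 0 z + r * e 1 z"
    using Y[of "\<lambda>y. e 0 (z + y)"] by (simp add: e1[simplified])
  also have "\<dots> = measure_pmf.expectation p (\<lambda>x. e (nat \<bar>Y x\<bar>) z)"
    using Y[of "\<lambda>y. e (nat \<bar>y\<bar>) z"] by simp
  also have "\<dots> = measure_pmf.expectation (replicate_pmf (Suc n) p)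
      (\<lambda>xs. (walk_step ^^ (\<Sum>x\<leftarrow>xs. nat \<bar>Y x\<bar>)) (\<lambda>x. \<bar>real_of_int x\<bar>) z)"
    unfolding expectation_replicate_pmf_Suc[OF fin] e_def by simp
  finally show ?case .
qed simp

text \<open>The number \<open>N\<close> of nonzero steps has mean \<open>\<mu> = n * r\<close> and
  variance at most \<open>\<mu>\<close>. Of the loss 2, one unit pays for the fluctuation of
  \<open>N\<close> and one for the bound on a walk of fixed length.\<close>

lemma expectation_abs_sum_ternary_ge:
  fixes Y :: "'a \<Rightarrow> int"
  assumes fin: "finite (set_pmf p)" and r: "0 \<le> r" "r \<le> 1"
    and Y: "\<And>f :: int \<Rightarrow> real. measure_pmf.expectation p (\<lambda>x. f (Y x)) = (1 - r) * f 0 + r * (f 1 + f (- 1)) / 2"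
  shows "measure_pmf.expectation (replicate_pmf n p) (\<lambda>xs. \<bar>real_of_int (\<Sum>x\<leftarrow>xs. Y x)\<bar>) \<ge>
    sqrt (2 / pi) * (sqrt (n * r) - 2)"
proof -
  define N where "N xs = (\<Sum>x\<leftarrow>xs. nat \<bar>Y x\<bar>)" for xs
  define \<mu> where "\<mu> = n * r"
  define h where "h x = real (nat \<bar>Y x\<bar>) - r" for x
  let ?E = "measure_pmf.expectation (replicate_pmf n p)"
  have Eh: "measure_pmf.expectation p h = 0"
    using Y[of "\<lambda>y. real (nat \<bar>y\<bar>) - r"] by (simp add: h_def[abs_def] field_simps)
  have Eh2: "measure_pmf.expectation p (\<lambda>x. (h x)\<^sup>2) \<le> r"
  proof -
    have "measure_pmf.expectation p (\<lambda>x. (h x)\<^sup>2) = r - r\<^sup>2"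
      using Y[of "\<lambda>y. (real (nat \<bar>y\<bar>) - r)\<^sup>2"] by (simp add: h_def power2_eq_square field_simps)
    then show ?thesis by simp
  qed
  have N: "(\<Sum>x\<leftarrow>xs. h x) = real (N xs) - real (length xs) * r" for xs
    by (induction xs) (simp_all add: N_def h_def algebra_simps)
  have "?E (\<lambda>xs. sqrt (N xs)) \<ge> sqrt \<mu> - 1"
  \<comment> \<open>For \<open>\<mu> \<ge> 1\<close> the variance term costs at most
    \<open>1 / (2 * sqrt \<mu>)\<close>, which is below 1; otherwise \<open>sqrt \<mu> - 1\<close>
    is negative.\<close>
  proof (cases "\<mu> \<ge> 1")
    case True
    have "sqrt \<mu> - 1 \<le> sqrt \<mu> * (1 - 1 / (2 * \<mu>))"
    proof -
      have "sqrt \<mu> * 1 \<le> sqrt \<mu> * sqrt \<mu>" using True by (intro mult_left_mono) auto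
      then have "sqrt \<mu> \<le> \<mu>" using True by simp
      then show ?thesis using True by (simp add: field_simps)
    qed
    also have "\<dots> \<le> sqrt \<mu> * (1 - n * measure_pmf.expectation p (\<lambda>x. (h x)\<^sup>2) / (2 * \<mu>\<^sup>2))"
    proof (intro mult_left_mono diff_left_mono)
      have "n * measure_pmf.expectation p (\<lambda>x. (h x)\<^sup>2) \<le> \<mu>"
        unfolding \<mu>_def by (intro mult_left_mono Eh2) simp
      then show "n * measure_pmf.expectation p (\<lambda>x. (h x)\<^sup>2) / (2 * \<mu>\<^sup>2) \<le> 1 / (2 * \<mu>)"
        using True by (simp add: field_simps power2_eq_square)
    qed (use True in simp)
    also have "\<dots> = ?E (\<lambda>xs. sqrt \<mu> * (1 + (\<Sum>x\<leftarrow>xs. h x) / (2 * \<mu>) - (\<Sum>x\<leftarrow>xs. h x)\<^sup>2 / (2 * \<mu>\<^sup>2)))"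
      using fin by (simp add: expectation_replicate_pmf_sum_list expectation_replicate_pmf_sum_list_square Eh)
    also have "\<dots> \<le> ?E (\<lambda>xs. sqrt (N xs))"
    proof (rule expectation_replicate_pmf_mono[OF fin])
      fix xs :: "'a list" assume "length xs = n"
      then have "(\<Sum>x\<leftarrow>xs. h x) = real (N xs) - \<mu>" by (simp add: N \<mu>_def)
      then show "sqrt \<mu> * (1 + (\<Sum>x\<leftarrow>xs. h x) / (2 * \<mu>) - (\<Sum>x\<leftarrow>xs. h x)\<^sup>2 / (2 * \<mu>\<^sup>2)) \<le> sqrt (N xs)"
        using sqrt_ge_parabola[of \<mu> "N xs"] True by simp
    qed
    finally show ?thesis .
  next
    case False
    then have "sqrt \<mu> - 1 \<le> 0" by simp
    also have "0 \<le> ?E (\<lambda>xs. sqrt (N xs))" by (intro Bochner_Integration.integral_nonneg) simp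
    finally show ?thesis .
  qed
  then have "sqrt (2 / pi) * (sqrt \<mu> - 2) \<le> sqrt (2 / pi) * (?E (\<lambda>xs. sqrt (N xs)) - 1)"
    by (intro mult_left_mono) auto
  also have "\<dots> = ?E (\<lambda>xs. sqrt (2 / pi) * (sqrt (N xs) - 1))"
    using fin by simp
  also have "\<dots> \<le> ?E (\<lambda>xs. (walk_step ^^ N xs) (\<lambda>x. \<bar>real_of_int x\<bar>) 0)"
    by (intro expectation_replicate_pmf_mono[OF fin] funpow_walk_step_abs_ge)
  also have "\<dots> = ?E (\<lambda>xs. \<bar>real_of_int (\<Sum>x\<leftarrow>xs. Y x)\<bar>)"
    using expectation_abs_sum_ternary[OF fin Y, where z = 0 and n = n] by (simp add: N_def)
  finally show ?thesis by (simp add: \<mu>_def)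
qed

subsection \<open>Proper clauses and the majority assignment\<close>

lemma proper_clause_sign_unique:
  "C \<in> proper_clauses k n \<Longrightarrow> (v, b) \<in> C \<Longrightarrow> (v, b') \<in> C \<Longrightarrow> b = b'"
  using inj_onD[of fst C "(v, b)" "(v, b')"] by (simp add: proper_clauses_def)

lemma finite_proper_clause: "C \<in> proper_clauses k n \<Longrightarrow> finite C"
  by (rule finite_subset[of _ "{1..n} \<times> UNIV"]) (auto simp: proper_clauses_def)

lemma finite_proper_clauses: "finite (proper_clauses k n)"
  by (rule finite_subset[of _ "Pow ({1..n} \<times> UNIV)"]) (auto simp: proper_clauses_def)

section \<open>Counting proper clauses\<close>

definition clause_of :: "nat set \<Rightarrow> nat set \<Rightarrow> clause" where
  "clause_of V T = (\<lambda>v. (v, v \<in> T)) ` V"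

lemma fst_clause_of [simp]: "fst ` clause_of V T = V"
  by (auto simp: clause_of_def image_iff)

lemma mem_clause_of: "(v, b) \<in> clause_of V T \<longleftrightarrow> v \<in> V \<and> (b \<longleftrightarrow> v \<in> T)"
  by (auto simp: clause_of_def)

text \<open>Coding a clause by its variables \<open>V\<close> and its positive variables
  \<open>T\<close> turns counts of clauses into counts of pairs of sets.\<close>

lemma bij_betw_clause_of:
  "bij_betw (\<lambda>(V, T). clause_of V T) (SIGMA V:{V. V \<subseteq> {1..n} \<and> card V = k}. Pow V) (proper_clauses k n)"
proof (rule bij_betwI[where g = "\<lambda>C. (fst ` C, {v. (v, True) \<in> C})"])
  show "(\<lambda>(V, T). clause_of V T) \<in> (SIGMA V:{V. V \<subseteq> {1..n} \<and> card V = k}. Pow V) \<rightarrow> proper_clauses k n"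
    by (auto simp: proper_clauses_def clause_of_def card_image inj_on_def)
  show "(\<lambda>C. (fst ` C, {v. (v, True) \<in> C})) \<in>
      proper_clauses k n \<rightarrow> (SIGMA V:{V. V \<subseteq> {1..n} \<and> card V = k}. Pow V)"
    by (force simp: proper_clauses_def card_image image_iff)
next
  fix C assume C: "C \<in> proper_clauses k n"
  have "clause_of (fst ` C) {v. (v, True) \<in> C} = C"
  proof (intro set_eqI, clarify)
    fix v b
    have "v \<in> fst ` C \<longleftrightarrow> (v, True) \<in> C \<or> (v, False) \<in> C"
      by (auto simp: image_iff Bex_def split_paired_Ex ex_bool_eq)
    then show "(v, b) \<in> clause_of (fst ` C) {v. (v, True) \<in> C} \<longleftrightarrow> (v, b) \<in> C"
      using proper_clause_sign_unique[OF C, of v True False]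
      by (cases b) (auto simp: mem_clause_of)
  qed
  then show "(case (fst ` C, {v. (v, True) \<in> C}) of (V, T) \<Rightarrow> clause_of V T) = C" by simp
qed (auto simp: mem_clause_of)

lemma card_proper_clauses_Collect:
  "card {C \<in> proper_clauses k n. P C} =
    (\<Sum>V | V \<subseteq> {1..n} \<and> card V = k. card {T. T \<subseteq> V \<and> P (clause_of V T)})"
proof -
  let ?S = "SIGMA V:{V. V \<subseteq> {1..n} \<and> card V = k}. {T. T \<subseteq> V \<and> P (clause_of V T)}"
  have bij: "inj_on (\<lambda>(V, T). clause_of V T) (SIGMA V:{V. V \<subseteq> {1..n} \<and> card V = k}. Pow V)"
    and im: "(\<lambda>(V, T). clause_of V T) ` (SIGMA V:{V. V \<subseteq> {1..n} \<and> card V = k}. Pow V) = proper_clauses k n"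
    using bij_betw_clause_of[of n k] by (auto simp: bij_betw_def)
  have "inj_on (\<lambda>(V, T). clause_of V T) ?S"
    by (rule inj_on_subset[OF bij]) auto
  moreover have "(\<lambda>(V, T). clause_of V T) ` ?S = {C \<in> proper_clauses k n. P C}"
    unfolding im[symmetric] by (auto simp: image_iff)
  ultimately have "card {C \<in> proper_clauses k n. P C} = card ?S"
    by (metis (no_types, lifting) card_image)
  also have "\<dots> = (\<Sum>V | V \<subseteq> {1..n} \<and> card V = k. card {T. T \<subseteq> V \<and> P (clause_of V T)})"
    by (rule card_SigmaI) (auto intro: finite_subset[of _ "Pow _"] finite_subset[of _ "{1..n}"])
  finally show ?thesis .
qed

lemma card_k_subsets: "card {V. V \<subseteq> {1..n} \<and> card V = k} = n choose k"
  using n_subsets[of "{1..n}" k] by simp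

lemma card_proper_clauses: "card (proper_clauses k n) = (n choose k) * 2 ^ k"
proof -
  have "card {C \<in> proper_clauses k n. True} = (\<Sum>V | V \<subseteq> {1..n} \<and> card V = k. 2 ^ k)"
    unfolding card_proper_clauses_Collect
    by (intro sum.cong refl) (auto simp: Pow_def[symmetric] intro!: card_Pow elim: finite_subset)
  then show ?thesis by (simp add: card_k_subsets[simplified])
qed

text \<open>On each variable set \<open>V\<close> exactly one clause is violated: its positive
  variables are those that \<sigma> makes false.\<close>

lemma card_not_satisfies: "card {C \<in> proper_clauses k n. \<not> satisfies \<sigma> C} = n choose k"
proof -
  have "{T. T \<subseteq> V \<and> \<not> satisfies \<sigma> (clause_of V T)} = {{v \<in> V. \<not> \<sigma> v}}" for V
    by (auto simp: satisfies_def clause_of_def)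
  then show ?thesis by (simp add: card_proper_clauses_Collect card_k_subsets[simplified])
qed

definition last_var :: "clause \<Rightarrow> nat" where
  "last_var C = Max (fst ` C)"

definition last_sign :: "clause \<Rightarrow> bool" where
  "last_sign C \<longleftrightarrow> (last_var C, True) \<in> C"

text \<open>Under an assignment that is true on all variables before the last one, exactly these clauses are
  still unsatisfied when the last variable is set.\<close>

definition decided_last :: "clause \<Rightarrow> bool" where
  "decided_last C \<longleftrightarrow> (\<forall>(v, b)\<in>C. v \<noteq> last_var C \<longrightarrow> \<not> b)"

lemma last_var_clause_of [simp]: "last_var (clause_of V T) = Max V"
  by (simp add: last_var_def)

lemma decided_last_clause_of: "T \<subseteq> V \<Longrightarrow> decided_last (clause_of V T) \<longleftrightarrow> T \<subseteq> {Max V}"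
proof -
  have "decided_last (clause_of V T) \<longleftrightarrow> (\<forall>v\<in>V. v \<noteq> Max V \<longrightarrow> v \<notin> T)"
    unfolding decided_last_def last_var_clause_of by (simp add: clause_of_def)
  then show "T \<subseteq> V \<Longrightarrow> decided_last (clause_of V T) \<longleftrightarrow> T \<subseteq> {Max V}" by blast
qed

lemma last_sign_clause_of: "finite V \<Longrightarrow> V \<noteq> {} \<Longrightarrow> last_sign (clause_of V T) \<longleftrightarrow> Max V \<in> T"
  by (auto simp: last_sign_def mem_clause_of)

text \<open>All literals but the last are forced to be negative, so each variable set leaves only
  the sign of its last variable free.\<close>

lemma card_decided_last:
  assumes "k \<ge> 1"
  shows "card {C \<in> proper_clauses k n. decided_last C} = 2 * (n choose k)"
proof -
  have "card {T. T \<subseteq> V \<and> decided_last (clause_of V T)} = 2" if "V \<subseteq> {1..n} \<and> card V = k" for V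
  proof -
    have "finite V" by (rule finite_subset[of _ "{1..n}"]) (use that in auto)
    moreover have "V \<noteq> {}" using that assms by auto
    ultimately have "Max V \<in> V" by simp
    then have "T \<subseteq> V \<and> decided_last (clause_of V T) \<longleftrightarrow> T \<in> Pow {Max V}" for T
      using decided_last_clause_of[of T V] by auto
    then show ?thesis by (simp only: Collect_mem_eq card_Pow finite.emptyI finite.insertI) simp
  qed
  then have "card {C \<in> proper_clauses k n. decided_last C} = (\<Sum>V | V \<subseteq> {1..n} \<and> card V = k. 2)"
    unfolding card_proper_clauses_Collect by (intro sum.cong refl) blast
  then show ?thesis by (simp add: card_k_subsets[simplified])
qed

lemma card_k_subsets_Max:
  assumes "k \<ge> 1" "i \<in> {1..n}"
  shows "card {V. V \<subseteq> {1..n} \<and> card V = k \<and> Max V = i} = (i - 1) choose (k - 1)"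
proof -
  have "bij_betw (insert i) {V. V \<subseteq> {1..i - 1} \<and> card V = k - 1} {V. V \<subseteq> {1..n} \<and> card V = k \<and> Max V = i}"
  proof (rule bij_betwI[where g = "\<lambda>V. V - {i}"])
    show "insert i \<in> {V. V \<subseteq> {1..i - 1} \<and> card V = k - 1} \<rightarrow> {V. V \<subseteq> {1..n} \<and> card V = k \<and> Max V = i}"
    proof (rule funcsetI)
      fix V assume "V \<in> {V. V \<subseteq> {1..i - 1} \<and> card V = k - 1}"
      then have V: "V \<subseteq> {1..i - 1}" "card V = k - 1" by auto
      have fin: "finite V" by (rule finite_subset[OF V(1)]) simp
      moreover have "i \<notin> V" using V assms by auto
      moreover have "Max (insert i V) = i"
      proof (rule Max_eqI)
        fix v assume "v \<in> insert i V"
        then show "v \<le> i" using V(1) by fastforce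
      qed (use fin in auto)
      moreover have "insert i V \<subseteq> {1..n}" using V(1) assms by fastforce
      ultimately show "insert i V \<in> {V. V \<subseteq> {1..n} \<and> card V = k \<and> Max V = i}"
        using V(2) assms(1) by simp
    qed
    show "(\<lambda>V. V - {i}) \<in> {V. V \<subseteq> {1..n} \<and> card V = k \<and> Max V = i} \<rightarrow> {V. V \<subseteq> {1..i - 1} \<and> card V = k - 1}"
    proof (rule funcsetI, clarify)
      fix V assume V: "V \<subseteq> {1..n}" "k = card V" "i = Max V"
      have fin: "finite V" by (rule finite_subset[OF V(1)]) simp
      have "V \<noteq> {}" using V assms by auto
      have "v \<in> {1..Max V - 1}" if "v \<in> V - {Max V}" for v
      proof -
        have "v \<le> Max V" "v \<noteq> Max V" "1 \<le> v" using that fin V(1) by auto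
        then show ?thesis by simp
      qed
      then have "V - {Max V} \<subseteq> {1..Max V - 1}" by blast
      then show "V - {Max V} \<subseteq> {1..Max V - 1} \<and> card (V - {Max V}) = card V - 1"
        using fin \<open>V \<noteq> {}\<close> by simp
    qed
  next
    fix V assume V: "V \<in> {V. V \<subseteq> {1..i - 1} \<and> card V = k - 1}"
    then show "insert i V - {i} = V" using assms by auto
  next
    fix V assume V: "V \<in> {V. V \<subseteq> {1..n} \<and> card V = k \<and> Max V = i}"
    have "finite V" by (rule finite_subset[of _ "{1..n}"]) (use V in auto)
    moreover have "V \<noteq> {}" using V assms by auto
    ultimately have "i \<in> V" using V Max_in[of V] by auto
    then show "insert i (V - {i}) = V" by auto
  qed
  from bij_betw_same_card[OF this] show ?thesis by (simp only: card_k_subsets)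
qed

text \<open>Once \<open>V\<close> has maximum \<open>i\<close>, the sign \<open>b\<close> fixes the
  clause. The count is the same for both \<open>b\<close>, which makes the votes at \<open>i\<close>
  symmetric.\<close>

lemma card_decided_last_sign:
  assumes "k \<ge> 1" "i \<in> {1..n}"
  shows "card {C \<in> proper_clauses k n. last_var C = i \<and> decided_last C \<and> last_sign C = b} =
    (i - 1) choose (k - 1)"
proof -
  have "card {T. T \<subseteq> V \<and> last_var (clause_of V T) = i \<and> decided_last (clause_of V T) \<and> last_sign (clause_of V T) = b} =
      (if Max V = i then 1 else 0)" if "V \<subseteq> {1..n} \<and> card V = k" for V
  proof -
    have "finite V" by (rule finite_subset[of _ "{1..n}"]) (use that in auto)
    moreover have "V \<noteq> {}" using that assms by auto
    ultimately have "Max V \<in> V" by simp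
    then have "{T. T \<subseteq> V \<and> last_var (clause_of V T) = i \<and> decided_last (clause_of V T) \<and> last_sign (clause_of V T) = b} =
        (if Max V = i then {if b then {i} else {}} else {})"
      by (auto simp: decided_last_clause_of last_sign_clause_of subset_singleton_iff \<open>finite V\<close> \<open>V \<noteq> {}\<close>)
    then show ?thesis by simp
  qed
  then have "card {C \<in> proper_clauses k n. last_var C = i \<and> decided_last C \<and> last_sign C = b} =
      (\<Sum>V | V \<subseteq> {1..n} \<and> card V = k. if Max V = i then 1 else 0)"
    unfolding card_proper_clauses_Collect by (intro sum.cong refl) blast
  also have "\<dots> = card ({V. V \<subseteq> {1..n} \<and> card V = k} \<inter> {V. Max V = i})"
  proof -
    have "finite {V. V \<subseteq> {1..n} \<and> card V = k}" by (rule finite_subset[of _ "Pow {1..n}"]) auto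
    then show ?thesis by (simp add: sum.If_cases)
  qed
  also have "{V. V \<subseteq> {1..n} \<and> card V = k} \<inter> {V. Max V = i} = {V. V \<subseteq> {1..n} \<and> card V = k \<and> Max V = i}"
    by auto
  finally show ?thesis by (simp only: card_k_subsets_Max[OF assms])
qed

section \<open>Votes, the majority assignment and the re-signing of clauses\<close>

definition vote :: "nat \<Rightarrow> clause \<Rightarrow> int" where
  "vote i C = (if last_var C = i \<and> decided_last C then (if last_sign C then 1 else - 1) else 0)"

text \<open>The new sign \<open>b = \<sigma> v\<close> is chosen so that \<sigma> satisfies the new
  literal exactly when \<open>b\<close> holds, that is, when the all-true assignment satisfies the
  old one.\<close>

definition flip_clause :: "(nat \<Rightarrow> bool) \<Rightarrow> clause \<Rightarrow> clause" where
  "flip_clause \<sigma> C = (\<lambda>(v, b). (v, if v = last_var C then b else b = \<sigma> v)) ` C"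

definition majority :: "formula \<Rightarrow> nat \<Rightarrow> bool" where
  "majority G i \<longleftrightarrow> (\<Sum>C\<leftarrow>G. vote i C) \<ge> 0"

definition flip_formula :: "formula \<Rightarrow> formula" where
  "flip_formula G = map (flip_clause (majority G)) G"

lemma fst_flip_clause: "fst ` flip_clause \<sigma> C = fst ` C"
  by (force simp: flip_clause_def image_iff)

lemma last_var_flip_clause [simp]: "last_var (flip_clause \<sigma> C) = last_var C"
  by (simp add: last_var_def fst_flip_clause)

lemma flip_clause_proper:
  assumes "C \<in> proper_clauses k n"
  shows "flip_clause \<sigma> C \<in> proper_clauses k n"
proof -
  have "inj_on (\<lambda>(v, b). (v, if v = last_var C then b else b = \<sigma> v)) C"
    by (rule inj_on_imageI2[of fst]) (use assms in \<open>simp add: proper_clauses_def comp_def case_prod_unfold\<close>)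
  then have "card (flip_clause \<sigma> C) = card C" by (simp add: flip_clause_def card_image)
  moreover have "flip_clause \<sigma> C \<subseteq> {1..n} \<times> UNIV"
    using assms by (auto simp: flip_clause_def proper_clauses_def)
  moreover have "inj_on fst (flip_clause \<sigma> C)"
  proof (rule inj_onI, clarsimp)
    fix v b b' assume "(v, b) \<in> flip_clause \<sigma> C" "(v, b') \<in> flip_clause \<sigma> C"
    then obtain c c' where "(v, c) \<in> C" "b = (if v = last_var C then c else c = \<sigma> v)"
        "(v, c') \<in> C" "b' = (if v = last_var C then c' else c' = \<sigma> v)"
      by (auto simp: flip_clause_def)
    then show "b = b'" using proper_clause_sign_unique[OF assms, of v c c'] by simp
  qed
  ultimately show ?thesis using assms by (simp add: proper_clauses_def)
qed

lemma le_last_var: "C \<in> proper_clauses k n \<Longrightarrow> (v, b) \<in> C \<Longrightarrow> v \<le> last_var C"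
  unfolding last_var_def
  by (rule Max_ge) (auto dest: finite_proper_clause intro: rev_image_eqI)

lemma last_var_mem:
  assumes "C \<in> proper_clauses k n" "k \<ge> 1"
  shows "(last_var C, last_sign C) \<in> C" "last_var C \<in> {1..n}"
proof -
  have "finite (fst ` C)" "fst ` C \<noteq> {}"
    using assms finite_proper_clause[OF assms(1)] by (auto simp: proper_clauses_def)
  then have "last_var C \<in> fst ` C" unfolding last_var_def by (rule Max_in)
  then obtain b where b: "(last_var C, b) \<in> C" by auto
  then have "last_sign C = b"
    using proper_clause_sign_unique[OF assms(1) b, of True] by (cases b) (auto simp: last_sign_def)
  then show "(last_var C, last_sign C) \<in> C" using b by simp
  show "last_var C \<in> {1..n}" using b assms by (auto simp: proper_clauses_def)
qed

text \<open>\<open>(b = \<sigma> v) = \<tau> v\<close> gives back \<open>b\<close> where the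
  assignments agree, and the literal of the last variable is never changed, so agreement below it
  suffices.\<close>

lemma flip_clause_flip_clause:
  assumes "C \<in> proper_clauses k n" and "\<And>v. v < last_var C \<Longrightarrow> \<tau> v = \<sigma> v"
  shows "flip_clause \<tau> (flip_clause \<sigma> C) = C"
proof -
  have "flip_clause \<tau> (flip_clause \<sigma> C) =
      (\<lambda>(v, b). (v, if v = last_var C then b else (b = \<sigma> v) = \<tau> v)) ` C"
    unfolding flip_clause_def[of \<tau>] last_var_flip_clause
    unfolding flip_clause_def image_image by (rule image_cong) auto
  also have "\<dots> = (\<lambda>x. x) ` C"
  proof (rule image_cong)
    fix x assume "x \<in> C"
    then show "(case x of (v, b) \<Rightarrow> (v, if v = last_var C then b else (b = \<sigma> v) = \<tau> v)) = x"
      using le_last_var[OF assms(1), of "fst x" "snd x"] assms(2)[of "fst x"]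
      by (auto simp: case_prod_unfold intro: prod_eqI)
  qed simp
  finally show ?thesis by simp
qed

text \<open>The assignment used for re-signing depends on the formula itself, so undoing the flips
  requires recovering the majorities from the image.\<close>

lemma inj_on_flip_formula:
  "inj_on flip_formula {G. set G \<subseteq> proper_clauses k n \<and> length G = m}"
proof (rule inj_onI)
  fix G H
  assume "G \<in> {G. set G \<subseteq> proper_clauses k n \<and> length G = m}"
    and "H \<in> {G. set G \<subseteq> proper_clauses k n \<and> length G = m}"
  then have GH: "set G \<subseteq> proper_clauses k n" "set H \<subseteq> proper_clauses k n" "length G = m" "length H = m"
    by auto
  assume eq: "flip_formula G = flip_formula H"
  have nth: "flip_clause (majority G) (G ! j) = flip_clause (majority H) (H ! j)" if "j < m" for j
    using arg_cong[OF eq, of "\<lambda>F. F ! j"] that GH by (simp add: flip_formula_def)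
  \<comment> \<open>Flipping preserves last variables, so both clauses have the same one; undoing
    both flips with \<open>majority G\<close> then recovers them.\<close>
  have nth_eq: "G ! j = H ! j" if "j < m" and "\<And>v. v < last_var (G ! j) \<Longrightarrow> majority G v = majority H v" for j
  proof -
    have mem: "G ! j \<in> proper_clauses k n" "H ! j \<in> proper_clauses k n"
      using GH that(1) by (metis nth_mem subsetD)+
    have last: "last_var (H ! j) = last_var (G ! j)"
      using arg_cong[OF nth[OF that(1)], of last_var] by simp
    have "G ! j = flip_clause (majority G) (flip_clause (majority G) (G ! j))"
      by (rule flip_clause_flip_clause[symmetric, OF mem(1)]) simp
    also have "\<dots> = flip_clause (majority G) (flip_clause (majority H) (H ! j))"
      by (simp only: nth[OF that(1)])
    also have "\<dots> = H ! j"
      by (rule flip_clause_flip_clause[OF mem(2)]) (use that(2) last in simp)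
    finally show ?thesis .
  qed
  \<comment> \<open>The majority at \<open>i\<close> depends only on the clauses with last variable \<open>i\<close>, and these are recovered
    from the flipped formula by the majorities below \<open>i\<close>.\<close>
  have "majority G i = majority H i" for i
  proof (induction i rule: less_induct)
    case (less i)
    have "vote i (G ! j) = vote i (H ! j)" if "j < m" for j
    proof (cases "last_var (G ! j) = i")
      case True
      have "G ! j = H ! j" by (rule nth_eq[OF that]) (use less True in blast)
      then show ?thesis by simp
    next
      case False
      then show ?thesis using arg_cong[OF nth[OF that], of last_var] by (simp add: vote_def)
    qed
    then have "map (vote i) G = map (vote i) H" using GH by (simp add: list_eq_iff_nth_eq)
    then show ?case by (simp add: majority_def)
  qed
  then have "G ! j = H ! j" if "j < m" for j by (intro nth_eq that)
  then show "G = H" using GH by (simp add: list_eq_iff_nth_eq)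
qed

text \<open>A flipped literal before the last variable is true under \<sigma> exactly when its old
  sign was positive. Such a literal exists unless \<open>decided_last C\<close>, and then only the
  last literal can help.\<close>

lemma satisfies_flip_clause:
  assumes "C \<in> proper_clauses k n" "k \<ge> 1"
  shows "satisfies \<sigma> (flip_clause \<sigma> C) \<longleftrightarrow> (decided_last C \<longrightarrow> last_sign C = \<sigma> (last_var C))"
proof -
  have uniq: "b = last_sign C" if "(last_var C, b) \<in> C" for b
    using proper_clause_sign_unique[OF assms(1) that last_var_mem(1)[OF assms]] .
  have "satisfies \<sigma> (flip_clause \<sigma> C) \<longleftrightarrow>
      (\<exists>x\<in>C. \<sigma> (fst x) = (if fst x = last_var C then snd x else snd x = \<sigma> (fst x)))"
    by (simp add: satisfies_def flip_clause_def case_prod_unfold)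
  also have "\<dots> \<longleftrightarrow> (\<exists>v b. (v, b) \<in> C \<and> (if v = last_var C then \<sigma> v = b else b))"
    unfolding Bex_def split_paired_Ex fst_conv snd_conv by (intro ex_cong1 conj_cong refl) auto
  also have "\<dots> \<longleftrightarrow> last_sign C = \<sigma> (last_var C) \<or> (\<exists>v b. (v, b) \<in> C \<and> v \<noteq> last_var C \<and> b)"
    (is "?L \<longleftrightarrow> ?A \<or> ?B")
  proof
    assume ?L
    then obtain v b where vb: "(v, b) \<in> C" "if v = last_var C then \<sigma> v = b else b" by blast
    show "?A \<or> ?B"
    proof (cases "v = last_var C")
      case True
      then have ?A using vb uniq[of b] by simp
      then show ?thesis ..
    next
      case False
      then have ?B using vb by (intro exI[of _ v] exI[of _ b]) simp
      then show ?thesis ..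
    qed
  next
    assume "?A \<or> ?B"
    then show ?L
    proof
      assume ?A
      then show ?L
        using last_var_mem(1)[OF assms] by (intro exI[of _ "last_var C"] exI[of _ "last_sign C"]) simp
    next
      assume ?B
      then obtain v b where "(v, b) \<in> C" "v \<noteq> last_var C" b by blast
      then show ?L by (intro exI[of _ v] exI[of _ b]) simp
    qed
  qed
  also have "(\<exists>v b. (v, b) \<in> C \<and> v \<noteq> last_var C \<and> b) \<longleftrightarrow> \<not> decided_last C"
    unfolding decided_last_def Ball_def split_paired_All case_prod_conv by blast
  finally show ?thesis by (simp only: imp_conv_disj disj_commute)
qed

text \<open>A clause that is not \<open>decided_last\<close> counts 1. A decided one counts 1/2 plus
  or minus 1/2, according to whether \<sigma> agrees with its vote at its last variable.\<close>

lemma num_satisfied_flip_clause: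
  assumes "set G \<subseteq> proper_clauses k n" "k \<ge> 1"
  shows "real (num_satisfied \<sigma> (map (flip_clause \<sigma>) G)) =
    length G - length (filter decided_last G) / 2 +
    (\<Sum>i=1..n. (if \<sigma> i then 1 else - 1) * real_of_int (\<Sum>C\<leftarrow>G. vote i C)) / 2"
  using assms(1)
proof (induction G)
  case (Cons C G)
  then have C: "C \<in> proper_clauses k n" by simp
  have "(\<Sum>i=1..n. (if \<sigma> i then 1 else - 1) * real_of_int (vote i C)) =
      (\<Sum>i=1..n. if i = last_var C then (if \<sigma> i then 1 else - 1) * real_of_int (vote i C) else 0)"
    by (intro sum.cong) (auto simp: vote_def)
  also have "\<dots> = (if \<sigma> (last_var C) then 1 else - 1) * real_of_int (vote (last_var C) C)"
    using last_var_mem(2)[OF C assms(2)] by simp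
  finally have sum: "(\<Sum>i=1..n. (if \<sigma> i then 1 else - 1) * real_of_int (vote i C)) =
      (if \<sigma> (last_var C) then 1 else - 1) * real_of_int (vote (last_var C) C)" .
  have sat: "(if satisfies \<sigma> (flip_clause \<sigma> C) then 1 else 0) = 1 - (if decided_last C then 1 else 0) / 2 +
      (if \<sigma> (last_var C) then 1 else - 1) * real_of_int (vote (last_var C) C) / 2"
    by (auto simp: satisfies_flip_clause[OF C assms(2)] vote_def)
  have num: "real (num_satisfied \<sigma> (map (flip_clause \<sigma>) (C # G))) =
      (if satisfies \<sigma> (flip_clause \<sigma> C) then 1 else 0) + real (num_satisfied \<sigma> (map (flip_clause \<sigma>) G))"
    by (simp add: num_satisfied_def)
  have "set G \<subseteq> proper_clauses k n" using Cons.prems by simp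
  note IH = Cons.IH[OF this]
  have split: "(\<Sum>i=1..n. (if \<sigma> i then 1 else - 1) * real_of_int (\<Sum>C\<leftarrow>C # G. vote i C)) =
      (if \<sigma> (last_var C) then 1 else - 1) * real_of_int (vote (last_var C) C) +
      (\<Sum>i=1..n. (if \<sigma> i then 1 else - 1) * real_of_int (\<Sum>C\<leftarrow>G. vote i C))"
    unfolding sum[symmetric] by (simp add: sum.distrib[symmetric] distrib_left)
  show ?case
    unfolding num sat IH split by (simp add: add_divide_distrib)
qed (simp add: num_satisfied_def)

lemma num_satisfied_le_max_sat:
  assumes "set F \<subseteq> proper_clauses k n"
  shows "num_satisfied \<sigma> F \<le> max_sat n F"
proof -
  \<comment> \<open>\<open>max_sat\<close> ranges over assignments that are undefined outside
    \<open>{1..n}\<close>; proper clauses do not see the difference.\<close>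
  have "satisfies \<sigma> C = satisfies (restrict \<sigma> {1..n}) C" if "C \<in> set F" for C
  proof -
    have "C \<subseteq> {1..n} \<times> UNIV" using that assms by (auto simp: proper_clauses_def)
    then show ?thesis unfolding satisfies_def by (intro bex_cong refl) auto
  qed
  then have "num_satisfied \<sigma> F = num_satisfied (restrict \<sigma> {1..n}) F"
    unfolding num_satisfied_def by (metis (mono_tags, lifting) filter_cong)
  also have "\<dots> \<le> max_sat n F"
    unfolding max_sat_def by (rule Max_ge) (auto intro!: finite_imageI finite_PiE)
  finally show ?thesis .
qed

text \<open>The majority assignment gives every sum of votes its own sign, so each signed sum
  becomes an absolute value.\<close>

lemma max_sat_flip_formula_ge:
  assumes "set G \<subseteq> proper_clauses k n" "k \<ge> 1"
  shows "real (max_sat n (flip_formula G)) \<ge>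
    length G - length (filter decided_last G) / 2 + (\<Sum>i=1..n. \<bar>real_of_int (\<Sum>C\<leftarrow>G. vote i C)\<bar>) / 2"
proof -
  have "(if majority G i then 1 else - 1) * real_of_int (\<Sum>C\<leftarrow>G. vote i C) =
      \<bar>real_of_int (\<Sum>C\<leftarrow>G. vote i C)\<bar>" for i
    by (auto simp: majority_def)
  then have "real (num_satisfied (majority G) (flip_formula G)) =
      length G - length (filter decided_last G) / 2 + (\<Sum>i=1..n. \<bar>real_of_int (\<Sum>C\<leftarrow>G. vote i C)\<bar>) / 2"
    using num_satisfied_flip_clause[OF assms, of "majority G"] by (simp add: flip_formula_def)
  moreover have "num_satisfied (majority G) (flip_formula G) \<le> max_sat n (flip_formula G)"
    using assms(1) by (intro num_satisfied_le_max_sat[where k = k]) (auto simp: flip_formula_def intro!: flip_clause_proper)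
  ultimately show ?thesis by linarith
qed

subsection \<open>Bounds for fixed \<open>n\<close>\<close>

lemma exp_mixture_le:
  fixes q t :: real
  assumes q: "1 / 2 \<le> q" "q < 1" and "0 \<le> t"
  shows "q * exp t + (1 - q) \<le> exp (t * q + t\<^sup>2 * q * (1 - q) / 2)"
proof -
  have pos: "q * exp x + (1 - q) > 0" for x using q by (intro add_pos_pos) auto
  \<comment> \<open>\<open>F\<close> is the claimed exponent minus the logarithm of the mixture. It
    vanishes at 0 and its derivative is a positive multiple of \<open>G\<close>; likewise
    \<open>G\<close> vanishes at 0 and has nonnegative derivative.\<close>
  define G where "G x = 1 - (1 - x * q) * (q * exp x + (1 - q))" for x
  define F where "F x = x * q + x\<^sup>2 * q * (1 - q) / 2 - ln (q * exp x + (1 - q))" for x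
  have G: "G x \<ge> 0" if "x \<ge> 0" for x
  proof -
    have "G 0 \<le> G x"
    proof (rule DERIV_nonneg_imp_nondecreasing[OF that])
      fix y :: real assume y: "0 \<le> y" "y \<le> x"
      have "(G has_real_derivative q * (exp y * (y * q - (1 - q)) + (1 - q))) (at y)"
        unfolding G_def by (auto intro!: derivative_eq_intros simp: algebra_simps)
      \<comment> \<open>Here \<open>q \<ge> 1 / 2\<close> enters: replacing \<open>y * q\<close> by
        \<open>y * (1 - q)\<close> leaves \<open>1 - q\<close> times
        \<open>1 - exp y * (1 - y)\<close>, which is nonnegative.\<close>
      moreover have "0 \<le> q * (exp y * (y * q - (1 - q)) + (1 - q))"
      proof -
        have "exp y * (1 - y) \<le> exp y * exp (- y)"
          using exp_ge_add_one_self[of "- y"] by (intro mult_left_mono) auto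
        then have "(1 - q) * (exp y * (1 - y)) \<le> (1 - q) * 1"
          using q by (intro mult_left_mono) (auto simp: exp_minus)
        moreover have "exp y * (y * q) \<ge> exp y * (y * (1 - q))"
          using q y by (intro mult_left_mono) auto
        ultimately have "0 \<le> exp y * (y * q - (1 - q)) + (1 - q)" by (simp add: algebra_simps)
        then show ?thesis using q by simp
      qed
      ultimately show "\<exists>d. (G has_real_derivative d) (at y) \<and> 0 \<le> d" by blast
    qed
    then show ?thesis by (simp add: G_def)
  qed
  have "F 0 \<le> F t"
  proof (rule DERIV_nonneg_imp_nondecreasing[OF assms(3)])
    fix y :: real assume y: "0 \<le> y" "y \<le> t"
    have "(F has_real_derivative q + y * q * (1 - q) - q * exp y / (q * exp y + (1 - q))) (at y)"
      unfolding F_def using pos[of y] by (auto intro!: derivative_eq_intros simp: field_simps)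
    moreover have "q + y * q * (1 - q) - q * exp y / (q * exp y + (1 - q)) =
        (1 - q) * G y / (q * exp y + (1 - q))"
      using pos[of y] by (simp add: G_def divide_simps) (simp add: algebra_simps)
    moreover have "0 \<le> (1 - q) * G y / (q * exp y + (1 - q))"
      using q G[OF y(1)] pos[of y] by (intro divide_nonneg_pos mult_nonneg_nonneg) auto
    ultimately show "\<exists>d. (F has_real_derivative d) (at y) \<and> 0 \<le> d" by metis
  qed
  then have "ln (q * exp t + (1 - q)) \<le> t * q + t\<^sup>2 * q * (1 - q) / 2"
    by (simp add: F_def)
  then show ?thesis using pos[of t] by (metis exp_le_cancel_iff exp_ln)
qed

lemma max_sat_attained: "\<exists>\<sigma>\<in>{1..n} \<rightarrow>\<^sub>E UNIV. max_sat n F = num_satisfied \<sigma> F"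
proof -
  have "finite ({1..n} \<rightarrow>\<^sub>E (UNIV :: bool set))" by (intro finite_PiE) auto
  moreover have "{1..n} \<rightarrow>\<^sub>E (UNIV :: bool set) \<noteq> {}" by (simp add: PiE_eq_empty_iff)
  ultimately have "max_sat n F \<in> (\<lambda>\<sigma>. num_satisfied \<sigma> F) ` ({1..n} \<rightarrow>\<^sub>E UNIV)"
    unfolding max_sat_def by (intro Max_in) auto
  then show ?thesis by blast
qed

lemma proper_clauses_ne: "k \<le> n \<Longrightarrow> proper_clauses k n \<noteq> {}"
  using card_proper_clauses[of k n] by (intro notI) (simp add: binomial_eq_0_iff)

lemma set_pmf_proper_clauses: "k \<le> n \<Longrightarrow> set_pmf (pmf_of_set (proper_clauses k n)) = proper_clauses k n"
  by (simp add: proper_clauses_ne finite_proper_clauses)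

lemma expectation_clause_if:
  fixes a b :: real
  assumes "k \<le> n"
  shows "measure_pmf.expectation (pmf_of_set (proper_clauses k n)) (\<lambda>C. if P C then a else b) =
    b + (a - b) * card {C \<in> proper_clauses k n. P C} / card (proper_clauses k n)"
proof -
  have fin: "finite (proper_clauses k n)" by (rule finite_proper_clauses)
  have "(\<Sum>C\<in>proper_clauses k n. if P C then a else b) =
      (\<Sum>C\<in>proper_clauses k n. b + (if P C then a - b else 0))"
    by (intro sum.cong) auto
  also have "\<dots> = card (proper_clauses k n) * b + card {C \<in> proper_clauses k n. P C} * (a - b)"
    using fin by (simp add: sum.distrib sum.If_cases Collect_conj_eq Int_commute)
  finally show ?thesis
    using proper_clauses_ne[OF assms] fin by (simp add: integral_pmf_of_set field_simps)
qed

text \<open>\<open>exp (t * max_sat n F)\<close> is at most the sum of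
  \<open>exp (t * num_satisfied \<sigma> F)\<close> over all assignments. Clauses are independent,
  so this sum has mean \<open>K = 2 ^ n * B ^ m\<close>.\<close>

lemma expected_max_sat_mgf_bound:
  fixes t :: real
  assumes k: "1 \<le> k" "k \<le> n" and "t \<ge> 0"
  defines "q \<equiv> 1 - 1 / 2 ^ k"
  shows "t * expected_max_sat k n m \<le> n * ln 2 + m * (t * q + t\<^sup>2 * q * (1 - q) / 2)"
proof -
  let ?p = "pmf_of_set (proper_clauses k n)"
  let ?E = "measure_pmf.expectation (replicate_pmf m ?p)"
  let ?A = "{1..n} \<rightarrow>\<^sub>E (UNIV :: bool set)"
  have fin: "finite (set_pmf ?p)" by (simp add: set_pmf_proper_clauses[OF k(2)] finite_proper_clauses)
  have "(2::real) ^ 1 \<le> 2 ^ k" using k by (intro power_increasing) auto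
  then have q: "1 / 2 \<le> q" "q < 1" by (simp_all add: q_def field_simps)
  define B where "B = q * exp t + (1 - q)"
  define K where "K = 2 ^ n * B ^ m"
  have B: "B > 0" unfolding B_def using q by (intro add_pos_pos) auto
  then have K: "K > 0" by (simp add: K_def)
  have choose: "n choose k > 0" using k by simp
  have EB: "measure_pmf.expectation ?p (\<lambda>C. if satisfies \<sigma> C then exp t else 1) = B" for \<sigma>
  proof -
    have "(\<lambda>C. if satisfies \<sigma> C then exp t else 1) = (\<lambda>C. if \<not> satisfies \<sigma> C then 1 else exp t)" by auto
    then show ?thesis
      using choose by (simp only: expectation_clause_if[OF k(2)] card_not_satisfies card_proper_clauses)
        (simp add: B_def q_def field_simps)
  qed
  have exp_num: "exp (t * num_satisfied \<sigma> F) = (\<Prod>C\<leftarrow>F. if satisfies \<sigma> C then exp t else 1)" for \<sigma> F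
    by (induction F) (simp_all add: num_satisfied_def distrib_left exp_add)
  have card: "card ?A = 2 ^ n" by (simp add: card_PiE)
  have finA: "finite ?A" by (intro finite_PiE) auto
  have "t * expected_max_sat k n m = ?E (\<lambda>F. t * max_sat n F)"
    by (simp add: expected_max_sat_def random_formula_def)
  \<comment> \<open>The tangent of \<open>ln\<close> at \<open>K\<close> takes the place of Jensen's
    inequality; after taking means the quotient \<open>K / K\<close> cancels the
    \<open>- 1\<close>.\<close>
  also have "\<dots> \<le> ?E (\<lambda>F. ln K - 1 + (\<Sum>\<sigma>\<in>?A. exp (t * num_satisfied \<sigma> F)) / K)"
  proof (rule expectation_replicate_pmf_mono[OF fin])
    fix F :: formula
    obtain \<sigma> where \<sigma>: "\<sigma> \<in> ?A" "max_sat n F = num_satisfied \<sigma> F" using max_sat_attained by blast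
    have "t * max_sat n F - ln K = ln (exp (t * max_sat n F) / K)"
      using K by (simp add: ln_div)
    also have "\<dots> \<le> exp (t * max_sat n F) / K - 1"
      using K by (intro ln_le_minus_one) simp
    also have "\<dots> \<le> (\<Sum>\<sigma>\<in>?A. exp (t * num_satisfied \<sigma> F)) / K - 1"
    proof -
      have "exp (t * num_satisfied \<sigma> F) \<le> (\<Sum>\<sigma>\<in>?A. exp (t * num_satisfied \<sigma> F))"
        using \<sigma> finA by (intro member_le_sum) auto
      then show ?thesis using K \<sigma>(2) by (simp add: divide_right_mono)
    qed
    finally show "t * max_sat n F \<le> ln K - 1 + (\<Sum>\<sigma>\<in>?A. exp (t * num_satisfied \<sigma> F)) / K" by simp
  qed
  also have "\<dots> = ln K - 1 + (\<Sum>\<sigma>\<in>?A. ?E (\<lambda>F. exp (t * num_satisfied \<sigma> F))) / K"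
    using fin by (simp add: Bochner_Integration.integral_sum)
  also have "(\<Sum>\<sigma>\<in>?A. ?E (\<lambda>F. exp (t * num_satisfied \<sigma> F))) = K"
    unfolding exp_num expectation_replicate_pmf_prod_list[OF fin] EB by (simp add: card K_def del: One_nat_def)
  also have "ln K - 1 + K / K = n * ln 2 + m * ln B"
    using K B by (simp add: K_def ln_mult ln_realpow)
  also have "\<dots> \<le> n * ln 2 + m * (t * q + t\<^sup>2 * q * (1 - q) / 2)"
  proof -
    have "ln B \<le> ln (exp (t * q + t\<^sup>2 * q * (1 - q) / 2))"
      using B exp_mixture_le[OF q assms(3)] unfolding B_def by (intro ln_mono) auto
    then show ?thesis by (simp add: mult_left_mono)
  qed
  finally show ?thesis .
qed

lemma expected_max_sat_le:
  fixes c :: real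
  assumes k: "1 \<le> k" "k \<le> n" and c: "c > 0"
  shows "expected_max_sat k n (nat \<lfloor>c * real n\<rfloor>) \<le>
    ((2 ^ k - 1) / 2 ^ k * c + sqrt c * sqrt ((2 ^ k - 1) * ln 2 / 2 ^ (2 * k - 1))) * real n"
proof -
  define q :: real where "q = 1 - 1 / 2 ^ k"
  define v where "v = q * (1 - q)"
  define s where "s = sqrt (2 * c * v * ln 2)"
  \<comment> \<open>This \<open>t\<close> minimises \<open>ln 2 / t + c * t * v / 2\<close>; both
    terms then equal \<open>s / 2\<close>, which gives \<open>q * c + s\<close> per
    variable.\<close>
  define t where "t = s / (c * v)"
  define m where "m = nat \<lfloor>c * real n\<rfloor>"
  have "(2::real) ^ 1 \<le> 2 ^ k" using k by (intro power_increasing) auto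
  then have q: "1 / 2 \<le> q" "q < 1" by (simp_all add: q_def field_simps)
  then have v: "v > 0" by (simp add: v_def)
  then have s: "s > 0" "s * s = 2 * c * v * ln 2" using c by (simp_all add: s_def)
  have l: "t > 0" using s v c by (simp add: t_def)
  have l2: "t\<^sup>2 * v / 2 = ln 2 / c" "2 * ln 2 = t * s"
    using s v c by (simp_all add: t_def power2_eq_square field_simps)
  have m: "m \<le> c * n" using c by (simp add: m_def)
  have "t * expected_max_sat k n m \<le> n * ln 2 + m * (t * q + t\<^sup>2 * q * (1 - q) / 2)"
    unfolding q_def using expected_max_sat_mgf_bound[OF k less_imp_le[OF l]] .
  also have "t\<^sup>2 * q * (1 - q) / 2 = ln 2 / c" using l2(1) by (simp add: v_def mult.assoc)
  also have "n * ln 2 + m * (t * q + ln 2 / c) \<le> n * ln 2 + (c * n) * (t * q + ln 2 / c)"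
    using m l q c by (intro add_left_mono mult_right_mono add_nonneg_nonneg) auto
  also have "\<dots> = t * ((q * c + s) * n)"
    using c l2(2) by (simp add: field_simps)
  finally have "expected_max_sat k n m \<le> (q * c + s) * n" using l by simp
  moreover have "q = (2 ^ k - 1) / 2 ^ k" by (simp add: q_def field_simps)
  moreover have "s = sqrt c * sqrt ((2 ^ k - 1) * ln 2 / 2 ^ (2 * k - 1))"
  proof -
    have "(2::real) * 2 ^ (2 * k - 1) = 2 ^ k * 2 ^ k"
      using k by (simp flip: power_Suc power_add add: mult_2)
    then have "2 * c * v * ln 2 = c * ((2 ^ k - 1) * ln 2 / 2 ^ (2 * k - 1))"
      by (simp add: v_def q_def divide_simps)
    then show ?thesis unfolding s_def by (simp only: real_sqrt_mult)
  qed
  ultimately show ?thesis by (simp add: m_def)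
qed

section \<open>Lower bound by the majority assignment\<close>

lemma expected_max_sat_ge:
  assumes k: "1 \<le> k" "k \<le> n"
  shows "expected_max_sat k n m \<ge> m * (1 - 1 / 2 ^ k) +
    (\<Sum>i=1..n. sqrt (2 / pi) *
      (sqrt (m * (2 * real ((i - 1) choose (k - 1)) / (2 ^ k * real (n choose k)))) - 2)) / 2"
proof -
  let ?A = "proper_clauses k n"
  let ?p = "pmf_of_set ?A"
  let ?E = "measure_pmf.expectation (replicate_pmf m ?p)"
  define r where "r i = 2 * real ((i - 1) choose (k - 1)) / (2 ^ k * real (n choose k))" for i
  have fin: "finite (set_pmf ?p)" by (simp add: set_pmf_proper_clauses[OF k(2)] finite_proper_clauses)
  have choose: "n choose k > 0" using k by simp
  \<comment> \<open>The vote is 1 or -1 with probability \<open>r i / 2\<close> each. It is split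
    into two indicators, one for each sign, to use the clause counts.\<close>
  have votes: "measure_pmf.expectation ?p (\<lambda>C. f (vote i C)) = (1 - r i) * f 0 + r i * (f 1 + f (- 1)) / 2"
    if "i \<in> {1..n}" for i and f :: "int \<Rightarrow> real"
  proof -
    have "measure_pmf.expectation ?p (\<lambda>C. f (vote i C)) = measure_pmf.expectation ?p (\<lambda>C.
        (if last_var C = i \<and> decided_last C \<and> last_sign C = True then f 1 - f 0 else 0) +
        (if last_var C = i \<and> decided_last C \<and> last_sign C = False then f (- 1) else f 0))"
      by (intro Bochner_Integration.integral_cong) (auto simp: vote_def)
    also have "\<dots> = (1 - r i) * f 0 + r i * (f 1 + f (- 1)) / 2"
      using choose
      by (subst Bochner_Integration.integral_add)
         (simp_all only: integrable_measure_pmf_finite[OF fin] expectation_clause_if[OF k(2)]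
           card_decided_last_sign[OF k(1) that] card_proper_clauses,
          simp add: r_def field_simps)
    finally show ?thesis .
  qed
  have r: "0 \<le> r i" "r i \<le> 1" if "i \<in> {1..n}" for i
  proof -
    show "0 \<le> r i" by (simp add: r_def)
    \<comment> \<open>\<open>1 - r i\<close> is the probability of a zero vote, hence
      nonnegative.\<close>
    have "1 - r i = measure_pmf.expectation ?p (\<lambda>C. if vote i C = 0 then 1 else 0)"
      using votes[OF that, of "\<lambda>x. if x = 0 then 1 else 0"] by simp
    also have "\<dots> \<ge> 0" by (intro Bochner_Integration.integral_nonneg) auto
    finally show "r i \<le> 1" by simp
  qed
  have decided: "?E (\<lambda>G. real (length (filter decided_last G))) = m * (2 / 2 ^ k)"
  proof -
    have "real (length (filter decided_last G)) = (\<Sum>C\<leftarrow>G. if decided_last C then 1 else 0)" for G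
      by (induction G) auto
    then have "?E (\<lambda>G. real (length (filter decided_last G))) =
        m * measure_pmf.expectation ?p (\<lambda>C. if decided_last C then 1 else 0)"
      by (simp add: expectation_replicate_pmf_sum_list[OF fin])
    then show ?thesis
      using choose by (simp only: expectation_clause_if[OF k(2)] card_decided_last[OF k(1)] card_proper_clauses) simp
  qed
  \<comment> \<open>A clause is decided at its last variable with probability
    \<open>2 / 2 ^ k\<close>, and half of these clauses are charged as lost; the variables are
    combined by linearity of expectation.\<close>
  have "m * (1 - 1 / 2 ^ k) + (\<Sum>i=1..n. sqrt (2 / pi) * (sqrt (m * r i) - 2)) / 2 \<le>
      m - m * (2 / 2 ^ k) / 2 + (\<Sum>i=1..n. ?E (\<lambda>G. \<bar>real_of_int (\<Sum>C\<leftarrow>G. vote i C)\<bar>)) / 2"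
  proof -
    have "(\<Sum>i=1..n. sqrt (2 / pi) * (sqrt (m * r i) - 2)) \<le>
        (\<Sum>i=1..n. ?E (\<lambda>G. \<bar>real_of_int (\<Sum>C\<leftarrow>G. vote i C)\<bar>))"
      by (intro sum_mono expectation_abs_sum_ternary_ge fin r votes)
    then show ?thesis by (simp add: algebra_simps)
  qed
  also have "\<dots> = ?E (\<lambda>G. m - length (filter decided_last G) / 2 +
      (\<Sum>i=1..n. \<bar>real_of_int (\<Sum>C\<leftarrow>G. vote i C)\<bar>) / 2)"
    using fin by (simp add: decided Bochner_Integration.integral_sum)
  also have "\<dots> \<le> ?E (\<lambda>G. real (max_sat n (flip_formula G)))"
  proof (rule expectation_replicate_pmf_mono[OF fin])
    fix G assume "set G \<subseteq> set_pmf ?p" "length G = m"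
    then show "m - length (filter decided_last G) / 2 +
        (\<Sum>i=1..n. \<bar>real_of_int (\<Sum>C\<leftarrow>G. vote i C)\<bar>) / 2 \<le> real (max_sat n (flip_formula G))"
      using max_sat_flip_formula_ge[of G k n] k by (simp add: set_pmf_proper_clauses)
  qed
  \<comment> \<open>Since \<open>flip_formula\<close> permutes the formulas, a flipped random
    formula has the law of a random formula.\<close>
  also have "\<dots> = expected_max_sat k n m"
    unfolding expected_max_sat_def random_formula_def
  proof (rule expectation_replicate_pmf_of_set_inj[where f = "\<lambda>F. real (max_sat n F)"])
    show "set (flip_formula G) \<subseteq> ?A \<and> length (flip_formula G) = m" if "set G \<subseteq> ?A" "length G = m" for G
      using that by (auto simp: flip_formula_def intro!: flip_clause_proper)
  qed (simp_all add: finite_proper_clauses proper_clauses_ne[OF k(2)] inj_on_flip_formula)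
  finally show ?thesis unfolding r_def .
qed

subsection \<open>Asymptotics\<close>

text \<open>The right-hand side is the falling factorial, each of whose \<open>b\<close> factors is
  at least \<open>a - b\<close>. Truncated subtraction covers \<open>a < b\<close>.\<close>

lemma choose_times_fact_ge: "(a - b) ^ b \<le> (a choose b) * fact b" for a b :: nat
proof (induction b)
  case (Suc b)
  have "(a - Suc b) ^ Suc b \<le> (a - b) ^ Suc b" by (intro power_mono) auto
  also have "\<dots> \<le> (a - b) * ((a choose b) * fact b)" using Suc by simp
  also have "\<dots> = (a choose Suc b) * fact (Suc b)"
  proof -
    have "(a - b) * (a choose b) = Suc b * (a choose Suc b)"
      by (simp only: binomial_absorb_comp binomial_absorption)
    then show ?thesis by (simp only: fact_Suc of_nat_id mult_ac)
  qed
  finally show ?case .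
qed simp

text \<open>The function sending \<open>x\<close> to \<open>x\<close> to the power
  \<open>(j + 2) / 2\<close> is convex, so it lies above its tangent at \<open>a\<^sup>2\<close>.
  Writing arguments as squares keeps all exponents natural.\<close>

lemma power_tangent_le:
  fixes a b :: real
  assumes "a \<ge> 0" "b \<ge> 0"
  shows "a ^ (j + 2) + (j + 2) / 2 * a ^ j * (b\<^sup>2 - a\<^sup>2) \<le> b ^ (j + 2)"
proof (induction j)
  case (Suc j)
  \<comment> \<open>The gap for \<open>Suc j\<close> is \<open>b\<close> times the gap for
    \<open>j\<close> plus a nonnegative remainder.\<close>
  have "b ^ (Suc j + 2) - (a ^ (Suc j + 2) + (Suc j + 2) / 2 * a ^ Suc j * (b\<^sup>2 - a\<^sup>2)) =
      b * (b ^ (j + 2) - (a ^ (j + 2) + (j + 2) / 2 * a ^ j * (b\<^sup>2 - a\<^sup>2))) +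
      a ^ j * (b - a)\<^sup>2 * ((j + 1) * a + (j + 2) * b) / 2"
    by (simp add: power2_eq_square field_simps)
  also have "\<dots> \<ge> 0"
  proof -
    have "0 \<le> b ^ (j + 2) - (a ^ (j + 2) + (j + 2) / 2 * a ^ j * (b\<^sup>2 - a\<^sup>2))" using Suc by (simp add: algebra_simps)
    then show ?thesis
      by (intro add_nonneg_nonneg mult_nonneg_nonneg divide_nonneg_nonneg zero_le_power zero_le_power2 assms) auto
  qed
  finally show ?case by simp
qed (simp add: power2_eq_square)

text \<open>The left-hand side is the integral of \<open>x\<close> to the power
  \<open>(k - 1) / 2\<close> over \<open>[0, N]\<close>. The tangent inequality at
  \<open>Suc N\<close> bounds each increment by the new summand.\<close>

lemma sum_sqrt_power_ge:
  fixes k N :: nat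
  assumes "k \<ge> 1"
  shows "2 / (real k + 1) * sqrt (real N) ^ (k + 1) \<le> (\<Sum>j=1..N. sqrt (real j) ^ (k - 1))"
proof (induction N)
  case (Suc N)
  have "2 / (real k + 1) * (sqrt (real (Suc N)) ^ (k + 1) - sqrt (real N) ^ (k + 1)) \<le> sqrt (real (Suc N)) ^ (k - 1)"
    using power_tangent_le[of "sqrt (Suc N)" "sqrt N" "k - 1"] assms by (simp add: field_simps)
  then show ?case using Suc by (simp add: algebra_simps)
qed simp

text \<open>Each ratio of binomials with \<open>i > k\<close> is at least
  \<open>k * (i - k) ^ (k - 1) / n ^ k\<close>, and the terms with \<open>i \<le> k\<close> are
  dropped. The shift by \<open>k\<close> costs the factor with \<open>(n - k) / n\<close>, which
  tends to 1.\<close>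

lemma sum_sqrt_choose_ge:
  fixes x :: real
  assumes k: "2 \<le> k" "k \<le> n" and x: "x \<ge> 0"
  shows "sqrt (x / n) * sqrt (k / 2 ^ (k - 1)) * (2 / (real k + 1)) * sqrt (real (n - k) / n) ^ (k + 1) * n \<le>
    (\<Sum>i=1..n. sqrt (x * (2 * real ((i - 1) choose (k - 1)) / (2 ^ k * real (n choose k)))))"
proof -
  define A where "A = sqrt (x * k / 2 ^ (k - 1) / n ^ k)"
  have n: "real n > 0" using k by simp
  have "sqrt (x / n) * sqrt (k / 2 ^ (k - 1)) * (2 / (real k + 1)) * sqrt (real (n - k) / n) ^ (k + 1) * n =
      A * (2 / (real k + 1) * sqrt (real (n - k)) ^ (k + 1))"
  proof -
    define w where "w = sqrt (real n)"
    have w: "w > 0" "real n = w * w" using n by (simp_all add: w_def)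
    have "sqrt (x / n) = sqrt x / w"
      and "sqrt (real (n - k) / n) ^ (k + 1) = sqrt (real (n - k)) ^ (k + 1) / w ^ (k + 1)"
      and "A = sqrt x * sqrt (k / 2 ^ (k - 1)) / w ^ k"
      by (simp_all add: A_def w_def real_sqrt_mult real_sqrt_divide real_sqrt_power power_divide)
    then show ?thesis using w(1) by (simp add: w(2) mult_ac)
  qed
  also have "\<dots> \<le> A * (\<Sum>j=1..n - k. sqrt (real j) ^ (k - 1))"
    using sum_sqrt_power_ge[of k "n - k"] k x by (intro mult_left_mono) (auto simp: A_def)
  also have "\<dots> = (\<Sum>i\<in>{k + 1..n}. A * sqrt (real (i - k)) ^ (k - 1))"
  proof -
    have "(\<Sum>j=1..n - k. sqrt (real j) ^ (k - 1)) = (\<Sum>i\<in>{1 + k..n - k + k}. sqrt (real (i - k)) ^ (k - 1))"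
      unfolding sum.shift_bounds_cl_nat_ivl by simp
    then show ?thesis using k by (simp add: sum_distrib_left)
  qed
  also have "\<dots> \<le> (\<Sum>i\<in>{k + 1..n}. sqrt (x * (2 * real ((i - 1) choose (k - 1)) / (2 ^ k * real (n choose k)))))"
  proof (intro sum_mono)
    fix i assume i: "i \<in> {k + 1..n}"
    have "real k * real (i - k) ^ (k - 1) / n ^ k \<le> real ((i - 1) choose (k - 1)) / real (n choose k)"
    proof -
      have "(i - 1 - (k - 1)) ^ (k - 1) \<le> ((i - 1) choose (k - 1)) * fact (k - 1)"
        by (rule choose_times_fact_ge)
      moreover have "i - 1 - (k - 1) = i - k" using k by simp
      ultimately have 1: "(i - k) ^ (k - 1) \<le> ((i - 1) choose (k - 1)) * fact (k - 1)" by simp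
      have 2: "(n choose k) * fact k \<le> n ^ k" by (rule binomial_fact_pow)
      have "k * (i - k) ^ (k - 1) * (n choose k) \<le> k * (((i - 1) choose (k - 1)) * fact (k - 1)) * (n choose k)"
        using 1 by (intro mult_right_mono mult_left_mono) auto
      also have "\<dots> = ((i - 1) choose (k - 1)) * ((n choose k) * fact k)"
        using k by (cases k) (simp_all add: algebra_simps)
      also have "\<dots> \<le> ((i - 1) choose (k - 1)) * n ^ k" using 2 by (rule mult_left_mono) simp
      finally have "real (k * (i - k) ^ (k - 1) * (n choose k)) \<le> real (((i - 1) choose (k - 1)) * n ^ k)"
        by (rule of_nat_mono)
      moreover have "real (n choose k) > 0" using k by simp
      ultimately show ?thesis using n by (simp add: field_simps)
    qed
    then have "x * 2 / 2 ^ k * (real k * real (i - k) ^ (k - 1) / n ^ k) \<le>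
        x * 2 / 2 ^ k * (real ((i - 1) choose (k - 1)) / real (n choose k))"
      using x by (intro mult_left_mono) auto
    moreover have "x * 2 / 2 ^ k * (real k * real (i - k) ^ (k - 1) / n ^ k) =
        x * k / 2 ^ (k - 1) / n ^ k * real (i - k) ^ (k - 1)"
      using k by (cases k) (simp_all add: field_simps)
    ultimately have "x * k / 2 ^ (k - 1) / n ^ k * real (i - k) ^ (k - 1) \<le>
        x * (2 * real ((i - 1) choose (k - 1)) / (2 ^ k * real (n choose k)))"
      by (simp add: mult_ac)
    then have "sqrt (x * k / 2 ^ (k - 1) / n ^ k * real (i - k) ^ (k - 1)) \<le>
        sqrt (x * (2 * real ((i - 1) choose (k - 1)) / (2 ^ k * real (n choose k))))"
      by (rule real_sqrt_le_mono)
    then show "A * sqrt (real (i - k)) ^ (k - 1) \<le> sqrt (x * (2 * real ((i - 1) choose (k - 1)) / (2 ^ k * real (n choose k))))"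
      unfolding A_def real_sqrt_mult[of "_ / _"] real_sqrt_power .
  qed
  also have "\<dots> \<le> (\<Sum>i=1..n. sqrt (x * (2 * real ((i - 1) choose (k - 1)) / (2 ^ k * real (n choose k)))))"
    using x by (intro sum_mono2) auto
  finally show ?thesis .
qed

lemma tendsto_nat_floor_div:
  fixes c :: real
  assumes "c \<ge> 0"
  shows "(\<lambda>n. real (nat \<lfloor>c * real n\<rfloor>) / real n) \<longlonglongrightarrow> c"
proof (rule real_tendsto_sandwich[of "\<lambda>n. c - 1 / real n" _ _ "\<lambda>n. c"])
  show "\<forall>\<^sub>F n in sequentially. c - 1 / real n \<le> real (nat \<lfloor>c * real n\<rfloor>) / real n"
    using eventually_gt_at_top[of 0]
  proof eventually_elim
    case (elim n)
    have "c * n - 1 \<le> real (nat \<lfloor>c * real n\<rfloor>)" using assms by linarith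
    then have "(c * n - 1) / n \<le> real (nat \<lfloor>c * real n\<rfloor>) / n" by (rule divide_right_mono) simp
    then show ?case using elim by (simp add: diff_divide_distrib)
  qed
  show "\<forall>\<^sub>F n in sequentially. real (nat \<lfloor>c * real n\<rfloor>) / real n \<le> c"
    using eventually_gt_at_top[of 0]
  proof eventually_elim
    case (elim n)
    have "real (nat \<lfloor>c * real n\<rfloor>) \<le> c * n" using assms by simp
    then show ?case using elim by (simp add: field_simps)
  qed
  show "(\<lambda>n. c - 1 / real n) \<longlonglongrightarrow> c" by real_asymp
qed simp

lemma eventually_expected_max_sat_ge:
  fixes c :: real
  assumes k: "k \<ge> 2" and c: "c > 0"
  shows "\<forall>\<^sub>F n in sequentially. ((2 ^ k - 1) / 2 ^ k * c
      + 2 / (real k + 1) * sqrt (c * real k / (pi * 2 ^ k)) - 1) * real n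
    \<le> expected_max_sat k n (nat \<lfloor>c * real n\<rfloor>)"
proof -
  define q :: real where "q = (2 ^ k - 1) / 2 ^ k"
  define m where "m n = nat \<lfloor>c * real n\<rfloor>" for n
  \<comment> \<open>\<open>h n\<close> is the lower bound for fixed \<open>n\<close>, divided by
    \<open>n\<close>, with the sum replaced by its estimate.\<close>
  define h where "h n = q * (m n / n) + sqrt (2 / pi) / 2 *
    (sqrt (m n / n) * sqrt (k / 2 ^ (k - 1)) * (2 / (real k + 1)) * sqrt (real (n - k) / n) ^ (k + 1) - 2)" for n
  define L where "L = q * c + 2 / (real k + 1) * sqrt (c * real k / (pi * 2 ^ k))"
  have "sqrt (2 / pi) / 2 * (sqrt c * sqrt (k / 2 ^ (k - 1))) = sqrt (c * real k / (pi * 2 ^ k))"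
  proof -
    have "sqrt (2 / pi) / 2 = sqrt (2 / pi / 4)" by (simp only: real_sqrt_divide[of _ 4] real_sqrt_four)
    then have "sqrt (2 / pi) / 2 * (sqrt c * sqrt (k / 2 ^ (k - 1))) = sqrt (2 / pi / 4 * (c * (k / 2 ^ (k - 1))))"
      by (simp only: real_sqrt_mult)
    also have "2 / pi / 4 * (c * (k / 2 ^ (k - 1))) = c * real k / (pi * 2 ^ k)"
      using k by (cases k) (simp_all add: field_simps)
    finally show ?thesis .
  qed
  then have L: "q * c + sqrt (2 / pi) / 2 * (sqrt c * sqrt (k / 2 ^ (k - 1)) * (2 / (real k + 1)) * sqrt 1 ^ (k + 1) - 2) =
      L - sqrt (2 / pi)"
    by (simp add: L_def algebra_simps)
  have m: "(\<lambda>n. m n / n) \<longlonglongrightarrow> c" unfolding m_def using c by (intro tendsto_nat_floor_div) simp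
  have "(\<lambda>n. real (n - k) / n) \<longlonglongrightarrow> 1"
  proof (rule Lim_transform_eventually)
    show "(\<lambda>n. (real n - real k) / real n) \<longlonglongrightarrow> 1" by real_asymp
    show "\<forall>\<^sub>F n in sequentially. (real n - real k) / real n = real (n - k) / n"
      using eventually_ge_at_top[of k] by eventually_elim (simp add: of_nat_diff)
  qed
  then have "h \<longlonglongrightarrow> L - sqrt (2 / pi)"
    unfolding h_def L[symmetric] by (intro tendsto_intros m)
  \<comment> \<open>The loss 2 in each walk bound, times \<open>sqrt (2 / pi) / 2\<close>, costs
    \<open>sqrt (2 / pi)\<close> per variable in the limit. The slack up to 1 absorbs the
    convergence in \<open>n\<close>.\<close>
  moreover have "sqrt (2 / pi) < 1" using pi_gt3 by simp
  ultimately have "\<forall>\<^sub>F n in sequentially. h n > L - 1" by (intro order_tendstoD(1)) auto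
  then show ?thesis
    using eventually_ge_at_top[of k]
  proof eventually_elim
    case (elim n)
    have n: "real n > 0" using elim k by simp
    have "(L - 1) * n \<le> h n * n" using elim n by (intro mult_right_mono) auto
    also have "h n * n = m n * q + sqrt (2 / pi) / 2 *
        (sqrt (m n / n) * sqrt (k / 2 ^ (k - 1)) * (2 / (real k + 1)) * sqrt (real (n - k) / n) ^ (k + 1) * n - 2 * n)"
      using n by (simp add: h_def algebra_simps)
    also have "\<dots> \<le> m n * q + sqrt (2 / pi) / 2 *
        ((\<Sum>i=1..n. sqrt (m n * (2 * real ((i - 1) choose (k - 1)) / (2 ^ k * real (n choose k))))) - 2 * n)"
      using sum_sqrt_choose_ge[OF k elim(2), of "m n"]
      by (intro add_left_mono mult_left_mono diff_right_mono) auto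
    also have "\<dots> = m n * (1 - 1 / 2 ^ k) +
        (\<Sum>i=1..n. sqrt (2 / pi) *
          (sqrt (m n * (2 * real ((i - 1) choose (k - 1)) / (2 ^ k * real (n choose k)))) - 2)) / 2"
    proof -
      have "q = 1 - 1 / 2 ^ k" by (simp add: q_def field_simps)
      then show ?thesis
        unfolding sum_distrib_left[symmetric] sum_subtractf by simp
    qed
    also have "\<dots> \<le> expected_max_sat k n (m n)"
      using k elim by (intro expected_max_sat_ge) auto
    finally show ?case by (simp add: L_def q_def m_def)
  qed
qed

text \<open>Both bounds hold outright for large \<open>n\<close>; positivity of \<open>b\<close>
  turns them into bounds on the ratio.\<close>

lemma asymp_le_eventuallyI:
  fixes a b :: "nat \<Rightarrow> real"
  assumes "\<forall>\<^sub>F n in sequentially. a n \<le> b n \<and> 0 < b n"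
  shows "asymp_le a b"
  unfolding asymp_le_def
proof (rule Limsup_bounded)
  show "\<forall>\<^sub>F n in sequentially. ereal (a n / b n) \<le> 1"
    using assms by eventually_elim simp
qed

theorem theorem15:
  fixes k :: nat
  assumes "k \<ge> 2"
  shows "\<exists>g :: real \<Rightarrow> real. g \<in> O(\<lambda>_. 1) \<and>
    (\<forall>\<^sub>F c in at_top.
       (\<lambda>n. ((2 ^ k - 1) / 2 ^ k * c
              + 2 / (real k + 1) * sqrt (c * real k / (pi * 2 ^ k)) - g c) * real n)
         \<lesssim> (\<lambda>n. expected_max_sat k n (nat \<lfloor>c * real n\<rfloor>)) \<and>
       (\<lambda>n. expected_max_sat k n (nat \<lfloor>c * real n\<rfloor>))
         \<lesssim> (\<lambda>n. ((2 ^ k - 1) / 2 ^ k * c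
                    + sqrt c * sqrt ((2 ^ k - 1) * ln 2 / 2 ^ (2 * k - 1))) * real n))"
proof (intro exI[of _ "\<lambda>_. 1"] conjI)
  \<comment> \<open>The constant 1 serves as the \<open>O(1)\<close> term for every
    \<open>c\<close>.\<close>
  show "\<forall>\<^sub>F c in at_top.
       (\<lambda>n. ((2 ^ k - 1) / 2 ^ k * c
              + 2 / (real k + 1) * sqrt (c * real k / (pi * 2 ^ k)) - 1) * real n)
         \<lesssim> (\<lambda>n. expected_max_sat k n (nat \<lfloor>c * real n\<rfloor>)) \<and>
       (\<lambda>n. expected_max_sat k n (nat \<lfloor>c * real n\<rfloor>))
         \<lesssim> (\<lambda>n. ((2 ^ k - 1) / 2 ^ k * c
                    + sqrt c * sqrt ((2 ^ k - 1) * ln 2 / 2 ^ (2 * k - 1))) * real n)"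
    \<comment> \<open>A clause is satisfied with probability at least 1/2, so \<open>c > 2\<close>
      keeps the main term above 1. The lower bound, and with it \<open>expected_max_sat\<close>, is
      then positive.\<close>
    using eventually_gt_at_top[of "2 :: real"]
  proof eventually_elim
    case (elim c)
    have "(2::real) ^ 1 \<le> 2 ^ k" using assms by (intro power_increasing) auto
    then have q: "1 / 2 \<le> (2 ^ k - 1) / (2 ^ k :: real)" by (simp add: field_simps)
    have qc: "(2 ^ k - 1) / 2 ^ k * c > 1"
    proof -
      have "(2 ^ k - 1) / 2 ^ k * 2 < (2 ^ k - 1) / 2 ^ k * c"
        using q elim by (intro mult_strict_left_mono) linarith+
      moreover have "1 \<le> (2 ^ k - 1) / (2 ^ k :: real) * 2" using mult_right_mono[OF q, of 2] by simp
      ultimately show ?thesis by (rule order.strict_trans1[rotated])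
    qed
    show ?case
    proof (intro conjI asymp_le_eventuallyI)
      show "\<forall>\<^sub>F n in sequentially. ((2 ^ k - 1) / 2 ^ k * c
          + 2 / (real k + 1) * sqrt (c * real k / (pi * 2 ^ k)) - 1) * real n
          \<le> expected_max_sat k n (nat \<lfloor>c * real n\<rfloor>) \<and> 0 < expected_max_sat k n (nat \<lfloor>c * real n\<rfloor>)"
        using eventually_expected_max_sat_ge[OF assms order.strict_trans[OF zero_less_numeral elim]]
          eventually_gt_at_top[of 0]
      proof eventually_elim
        case (elim n)
        have "0 \<le> 2 / (real k + 1) * sqrt (c * real k / (pi * 2 ^ k))" using \<open>c > 2\<close> by simp
        then have "0 < ((2 ^ k - 1) / 2 ^ k * c + 2 / (real k + 1) * sqrt (c * real k / (pi * 2 ^ k)) - 1) * real n"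
        proof (intro mult_pos_pos)
          show "0 < (2 ^ k - 1) / 2 ^ k * c + 2 / (real k + 1) * sqrt (c * real k / (pi * 2 ^ k)) - 1"
            using qc \<open>0 \<le> 2 / (real k + 1) * sqrt (c * real k / (pi * 2 ^ k))\<close> by linarith
        qed (use elim in simp)
        then show ?case using elim by linarith
      qed
      show "\<forall>\<^sub>F n in sequentially. expected_max_sat k n (nat \<lfloor>c * real n\<rfloor>)
          \<le> ((2 ^ k - 1) / 2 ^ k * c + sqrt c * sqrt ((2 ^ k - 1) * ln 2 / 2 ^ (2 * k - 1))) * real n \<and>
          0 < ((2 ^ k - 1) / 2 ^ k * c + sqrt c * sqrt ((2 ^ k - 1) * ln 2 / 2 ^ (2 * k - 1))) * real n"
        using eventually_ge_at_top[of k]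
      proof eventually_elim
        case (elim n)
        have "0 \<le> sqrt c * sqrt ((2 ^ k - 1) * ln 2 / 2 ^ (2 * k - 1))" using \<open>c > 2\<close> by simp
        then have "0 < ((2 ^ k - 1) / 2 ^ k * c + sqrt c * sqrt ((2 ^ k - 1) * ln 2 / 2 ^ (2 * k - 1))) * real n"
        proof (intro mult_pos_pos)
          show "0 < (2 ^ k - 1) / 2 ^ k * c + sqrt c * sqrt ((2 ^ k - 1) * ln 2 / 2 ^ (2 * k - 1))"
            using qc \<open>0 \<le> sqrt c * sqrt ((2 ^ k - 1) * ln 2 / 2 ^ (2 * k - 1))\<close> by linarith
        qed (use elim assms in simp)
        then show ?case using expected_max_sat_le[of k n c] elim assms \<open>c > 2\<close> by simp
      qed
    qed
  qed
qed simp

end
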